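(* Let $\beta=\{\beta_\alpha:\alpha\in\mathbb N^d\}$ be a multisequence of positive real numbers and let $\mathscr M_z$ be bounded on $\mathcal H^2(\beta)$. Then the following statements are equivalent: (i) $\mathscr M_z$ on $\mathcal H^2(\beta)$ is weakly $\mathcal U(d)$-homogeneous. (ii) $\mathscr M_z$ on $\mathcal H^2(\beta)$ is similar to a $\mathcal U(d)$-homogeneous tuple $\mathscr M_z$ on some $\mathcal H^2(\tilde\beta)$, where $\tilde\beta$ is a multisequence of positive real numbers indexed by $\mathbb N^d$. (iii) $$\sup_{n\in\mathbb N}\left\{\max_{|\alpha|=n}\frac{\|z^\alpha\|_{\mathcal H^2(\beta)}}{\sqrt{\alpha!}}\ \max_{|\delta|=n}\frac{\sqrt{\delta!}}{\|z^\delta\|_{\mathcal H^2(\beta)}}\right\}<\infty,$$ where $\alpha,\delta$ range over $\mathbb N^d$. (iv) The family $\{C_u:u\in\mathcal U(d)\}$ of composition operators on $\mathcal H^2(\beta)$ is uniformly bounded, i.e. each $C_u$ is a bounded operator on $\mathcal H^2(\beta)$ and $\sup_{u\in\mathcal U(d)}\|C_u\|<\infty$.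
   Context: $\mathbb N$ is the set of non-negative integers; for $\alpha\in\mathbb N^d$, $|\alpha|=\sum_j\alpha_j$ and $\alpha!=\prod_j\alpha_j!$. For a multisequence $\beta$ of positive reals, $\mathcal H^2(\beta)$ is the Hilbert space of formal power series $f=\sum_{\alpha\in\mathbb N^d}a_\alpha z^\alpha$, $a_\alpha\in\mathbb C$, in $z=(z_1,\ldots,z_d)$ with $\|f\|^2=\sum_\alpha|a_\alpha|^2\beta_\alpha^2<\infty$ and inner product $\langle f,g\rangle=\sum_\alpha a_\alpha\overline{b_\alpha}\beta_\alpha^2$ for $g=\sum_\alpha b_\alpha z^\alpha$; thus $\|z^\alpha\|_{\mathcal H^2(\beta)}=\beta_\alpha$. $\mathscr M_z=(\mathscr M_{z_1},\ldots,\mathscr M_{z_d})$ with $\mathscr M_{z_j}f=z_jf$. $\mathcal U(d)$ is the group of $d\times d$ complex unitary matrices; for $u=(u_{jk})\in\mathcal U(d)$, $u\cdot z$ is the usual matrix product, with $j$-th entry $\sum_k u_{jk}z_k$. $C_u$ is the linear transformation in $\mathcal H^2(\beta)$ given by $C_uf(z)=f(u\cdot z)$ (formal substitution, well defined degree by degree), which is densely defined and may be unbounded. For a $d$-tuple $T$ of operators, $(u\cdot T)_j=\sum_{k=1}^d u_{jk}T_k$. A commuting $d$-tuple $T$ of bounded operators on a complex separable Hilbert space $\mathcal H$ is $\mathcal U(d)$-homogeneous if for every $u\in\mathcal U(d)$ there is a unitary $V$ on $\mathcal H$ with $VT_j=(u\cdot T)_jV$ for all $j$; it is weakly $\mathcal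 U(d)$-homogeneous if for every $u\in\mathcal U(d)$ there is a bounded invertible operator $\Gamma(u)$ on $\mathcal H$ with $\Gamma(u)T_j=(u\cdot T)_j\Gamma(u)$ for all $j$. Tuples $T$ on $\mathcal H$ and $T'$ on $\mathcal H'$ are similar if there is a bounded invertible $S:\mathcal H\to\mathcal H'$ with $ST_j=T'_jS$ for all $j$. *)

theory Defs
  imports "HOL-Analysis.Analysis" "HOL-Library.Poly_Mapping"
begin

section \<open>Multi-indices\<close>

text \<open>The index set is \<open>nat ^ 'd\<close>, with \<open>d = CARD('d)\<close>.\<close>

definition mlen :: "nat ^ 'd::finite \<Rightarrow> nat"
  where "mlen \<alpha> = (\<Sum>j\<in>UNIV. \<alpha> $ j)"

definition mfact :: "nat ^ 'd::finite \<Rightarrow> real"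
  where "mfact \<alpha> = (\<Prod>j\<in>UNIV. fact (\<alpha> $ j))"

text \<open>The sums and maxima over a fixed degree below therefore range over finite nonempty sets.\<close>

lemma finite_mlen_eq: "finite {\<alpha> :: nat ^ 'd::finite. mlen \<alpha> = n}"
proof -
  have "{\<alpha> :: nat ^ 'd. mlen \<alpha> = n} \<subseteq> vec_lambda ` (PiE UNIV (\<lambda>_. {..n}))"
  proof
    fix \<alpha> :: "nat ^ 'd" assume "\<alpha> \<in> {\<alpha>. mlen \<alpha> = n}"
    then have "\<alpha> $ j \<le> n" for j
      unfolding mlen_def using member_le_sum[of j UNIV "\<lambda>j. \<alpha> $ j"] by auto
    then have "(\<lambda>j. \<alpha> $ j) \<in> PiE UNIV (\<lambda>_. {..n})" by auto
    then show "\<alpha> \<in> vec_lambda ` (PiE UNIV (\<lambda>_. {..n}))"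
      by (metis image_eqI vec_nth_inverse)
  qed
  then show ?thesis
    by (meson finite_PiE finite_atMost finite_imageI finite_subset finite)
qed

lemma ex_mlen_eq: "\<exists>\<alpha> :: nat ^ 'd::finite. mlen \<alpha> = n"
proof
  show "mlen (axis undefined n :: nat ^ 'd) = n"
    by (simp add: mlen_def axis_def if_distrib cong: if_cong)
qed

section \<open>Operators between Hilbert spaces\<close>

text \<open>
  A space consists of families of complex numbers indexed by \<open>'i\<close>, with the pointwise
  vector space operations. Operators are total functions on all families; only their
  values on the carrier matter.
\<close>

record 'i hspace =
  hcarrier :: "('i \<Rightarrow> complex) set"
  hinner :: "('i \<Rightarrow> complex) \<Rightarrow> ('i \<Rightarrow> complex) \<Rightarrow> complex"

definition hnorm :: "'i hspace \<Rightarrow> ('i \<Rightarrow> complex) \<Rightarrow> real"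
  where "hnorm H f = sqrt (Re (hinner H f f))"

definition linear_op ::
    "'i hspace \<Rightarrow> 'k hspace \<Rightarrow> (('i \<Rightarrow> complex) \<Rightarrow> ('k \<Rightarrow> complex)) \<Rightarrow> bool"
  where "linear_op H K T \<longleftrightarrow>
    (\<forall>f \<in> hcarrier H. T f \<in> hcarrier K) \<and>
    (\<forall>f \<in> hcarrier H. \<forall>g \<in> hcarrier H. T (\<lambda>i. f i + g i) = (\<lambda>k. T f k + T g k)) \<and>
    (\<forall>c. \<forall>f \<in> hcarrier H. T (\<lambda>i. c * f i) = (\<lambda>k. c * T f k))"

definition bounded_op ::
    "'i hspace \<Rightarrow> 'k hspace \<Rightarrow> (('i \<Rightarrow> complex) \<Rightarrow> ('k \<Rightarrow> complex)) \<Rightarrow> bool"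
  where "bounded_op H K T \<longleftrightarrow>
    linear_op H K T \<and> (\<exists>C. \<forall>f \<in> hcarrier H. hnorm K (T f) \<le> C * hnorm H f)"

text \<open>The supremum is meaningful only for bounded operators.\<close>

definition opnorm ::
    "'i hspace \<Rightarrow> 'k hspace \<Rightarrow> (('i \<Rightarrow> complex) \<Rightarrow> ('k \<Rightarrow> complex)) \<Rightarrow> real"
  where "opnorm H K T = Sup {hnorm K (T f) | f. f \<in> hcarrier H \<and> hnorm H f \<le> 1}"

definition invertible_op ::
    "'i hspace \<Rightarrow> 'k hspace \<Rightarrow> (('i \<Rightarrow> complex) \<Rightarrow> ('k \<Rightarrow> complex)) \<Rightarrow> bool"
  where "invertible_op H K S \<longleftrightarrow> bounded_op H K S \<and>
    (\<exists>R. bounded_op K H R \<and> (\<forall>f \<in> hcarrier H. R (S f) = f) \<and> (\<forall>g \<in> hcarrier K. S (R g) = g))"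

definition unitary_op ::
    "'i hspace \<Rightarrow> 'k hspace \<Rightarrow> (('i \<Rightarrow> complex) \<Rightarrow> ('k \<Rightarrow> complex)) \<Rightarrow> bool"
  where "unitary_op H K V \<longleftrightarrow> linear_op H K V \<and> V ` hcarrier H = hcarrier K \<and>
    (\<forall>f \<in> hcarrier H. \<forall>g \<in> hcarrier H. hinner K (V f) (V g) = hinner H f g)"

section \<open>Homogeneity of operator tuples\<close>

definition unitary_group :: "(complex ^ 'd ^ 'd::finite) set"
  where "unitary_group = {u. u ** (\<chi> i j. cnj (u $ j $ i)) = mat 1 \<and>
                             (\<chi> i j. cnj (u $ j $ i)) ** u = mat 1}"

type_synonym ('d, 'i) op_tuple = "'d \<Rightarrow> ('i \<Rightarrow> complex) \<Rightarrow> ('i \<Rightarrow> complex)"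

definition tuple_act ::
    "complex ^ 'd ^ 'd::finite \<Rightarrow> ('d, 'i) op_tuple \<Rightarrow> ('d, 'i) op_tuple"
  where "tuple_act u T j f = (\<lambda>i. \<Sum>k\<in>UNIV. u $ j $ k * T k f i)"

definition bounded_tuple :: "'i hspace \<Rightarrow> ('d::finite, 'i) op_tuple \<Rightarrow> bool"
  where "bounded_tuple H T \<longleftrightarrow> (\<forall>j. bounded_op H H (T j))"

definition commuting_tuple :: "'i hspace \<Rightarrow> ('d::finite, 'i) op_tuple \<Rightarrow> bool"
  where "commuting_tuple H T \<longleftrightarrow> (\<forall>j k. \<forall>f \<in> hcarrier H. T j (T k f) = T k (T j f))"

definition homogeneous :: "'i hspace \<Rightarrow> ('d::finite, 'i) op_tuple \<Rightarrow> bool"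
  where "homogeneous H T \<longleftrightarrow> bounded_tuple H T \<and> commuting_tuple H T \<and>
    (\<forall>u \<in> unitary_group. \<exists>V. unitary_op H H V \<and>
       (\<forall>j. \<forall>f \<in> hcarrier H. V (T j f) = tuple_act u T j (V f)))"

definition weakly_homogeneous :: "'i hspace \<Rightarrow> ('d::finite, 'i) op_tuple \<Rightarrow> bool"
  where "weakly_homogeneous H T \<longleftrightarrow> bounded_tuple H T \<and> commuting_tuple H T \<and>
    (\<forall>u \<in> unitary_group. \<exists>\<Gamma>. invertible_op H H \<Gamma> \<and>
       (\<forall>j. \<forall>f \<in> hcarrier H. \<Gamma> (T j f) = tuple_act u T j (\<Gamma> f)))"

definition similar_tuples ::
    "'i hspace \<Rightarrow> ('d::finite, 'i) op_tuple \<Rightarrow> 'k hspace \<Rightarrow> ('d, 'k) op_tuple \<Rightarrow> bool"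
  where "similar_tuples H T K T' \<longleftrightarrow>
    (\<exists>S. invertible_op H K S \<and> (\<forall>j. \<forall>f \<in> hcarrier H. S (T j f) = T' j (S f)))"

section \<open>Weighted power series spaces\<close>

text \<open>A formal power series is identified with its family of coefficients.\<close>

type_synonym 'd pseries = "nat ^ 'd \<Rightarrow> complex"

definition H2 :: "(nat ^ 'd::finite \<Rightarrow> real) \<Rightarrow> (nat ^ 'd) hspace"
  where "H2 \<beta> =
    \<lparr> hcarrier = {f. (\<lambda>\<alpha>. (cmod (f \<alpha>))\<^sup>2 * (\<beta> \<alpha>)\<^sup>2) summable_on UNIV},
      hinner = (\<lambda>f g. \<Sum>\<^sub>\<infinity>\<alpha>. f \<alpha> * cnj (g \<alpha>) * (complex_of_real (\<beta> \<alpha>))\<^sup>2) \<rparr>"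

definition zmonom :: "nat ^ 'd::finite \<Rightarrow> 'd pseries"
  where "zmonom \<alpha> = (\<lambda>\<gamma>. if \<gamma> = \<alpha> then 1 else 0)"

definition Mz :: "('d::finite, nat ^ 'd) op_tuple"
  where "Mz j f = (\<lambda>\<alpha>. if \<alpha> $ j = 0 then 0 else f (\<alpha> - axis j 1))"

text \<open>
  The polynomial ring in the variables \<open>z\<^sub>k\<close> is \<open>(nat ^ 'd) \<Rightarrow>\<^sub>0 complex\<close> with the
  convolution product; \<open>z\<^sub>k\<close> is \<open>Poly_Mapping.single (axis k 1) 1\<close>.
  \<open>subst_monom u \<alpha>\<close> is the polynomial \<open>(u \<cdot> z)\<^sup>\<alpha>\<close>. It is homogeneous of degree \<open>mlen \<alpha>\<close>,
  so the coefficient of \<open>z\<^sup>\<gamma>\<close> in \<open>f(u \<cdot> z)\<close> involves only the finitely many coefficients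
  of \<open>f\<close> of degree \<open>mlen \<gamma>\<close>.
\<close>

definition subst_monom :: "complex ^ 'd ^ 'd::finite \<Rightarrow> nat ^ 'd \<Rightarrow> (nat ^ 'd) \<Rightarrow>\<^sub>0 complex"
  where "subst_monom u \<alpha> =
    (\<Prod>j\<in>UNIV. (\<Sum>k\<in>UNIV. Poly_Mapping.single (axis k 1) (u $ j $ k)) ^ (\<alpha> $ j))"

definition comp_op :: "complex ^ 'd ^ 'd::finite \<Rightarrow> 'd pseries \<Rightarrow> 'd pseries"
  where "comp_op u f =
    (\<lambda>\<gamma>. \<Sum>\<alpha> | mlen \<alpha> = mlen \<gamma>. f \<alpha> * Poly_Mapping.lookup (subst_monom u \<alpha>) \<gamma>)"

lemma hnorm_H2:
  assumes "f \<in> hcarrier (H2 \<beta>)"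
  shows "hnorm (H2 \<beta>) f = sqrt (\<Sum>\<^sub>\<infinity>\<alpha>. (cmod (f \<alpha>))\<^sup>2 * (\<beta> \<alpha>)\<^sup>2)"
proof -
  have "f \<alpha> * cnj (f \<alpha>) * (complex_of_real (\<beta> \<alpha>))\<^sup>2
      = complex_of_real ((cmod (f \<alpha>))\<^sup>2 * (\<beta> \<alpha>)\<^sup>2)" for \<alpha>
    by (simp only: of_real_mult of_real_power complex_norm_square[symmetric])
  moreover have "((\<lambda>\<alpha>. (cmod (f \<alpha>))\<^sup>2 * (\<beta> \<alpha>)\<^sup>2) has_sum
      (\<Sum>\<^sub>\<infinity>\<alpha>. (cmod (f \<alpha>))\<^sup>2 * (\<beta> \<alpha>)\<^sup>2)) UNIV"
    using assms by (simp add: H2_def has_sum_infsum)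
  then have "(\<Sum>\<^sub>\<infinity>\<alpha>. complex_of_real ((cmod (f \<alpha>))\<^sup>2 * (\<beta> \<alpha>)\<^sup>2))
      = complex_of_real (\<Sum>\<^sub>\<infinity>\<alpha>. (cmod (f \<alpha>))\<^sup>2 * (\<beta> \<alpha>)\<^sup>2)"
    by (intro infsumI has_sum_of_real)
  ultimately show ?thesis
    by (simp add: hnorm_def H2_def del: of_real_mult of_real_power)
qed

lemma hnorm_zmonom:
  assumes "\<beta> \<alpha> > 0"
  shows "zmonom \<alpha> \<in> hcarrier (H2 \<beta>)" and "hnorm (H2 \<beta>) (zmonom \<alpha>) = \<beta> \<alpha>"
proof -
  have *: "((\<lambda>\<gamma>. (cmod (zmonom \<alpha> \<gamma>))\<^sup>2 * (\<beta> \<gamma>)\<^sup>2) has_sum (\<beta> \<alpha>)\<^sup>2) UNIV"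
    using has_sum_finite_neutralI[of "{\<alpha>}" UNIV "\<lambda>\<gamma>. (cmod (zmonom \<alpha> \<gamma>))\<^sup>2 * (\<beta> \<gamma>)\<^sup>2"]
    by (simp add: zmonom_def)
  then show mem: "zmonom \<alpha> \<in> hcarrier (H2 \<beta>)"
    by (auto simp: H2_def has_sum_imp_summable)
  show "hnorm (H2 \<beta>) (zmonom \<alpha>) = \<beta> \<alpha>"
    using hnorm_H2[OF mem] infsumI[OF *] assms by simp
qed

lemma commuting_Mz: "commuting_tuple H (Mz :: ('d::finite, nat ^ 'd) op_tuple)"
proof -
  have "\<alpha> - axis j 1 - axis k 1 = \<alpha> - axis k 1 - axis j (1::nat)" for \<alpha> :: "nat ^ 'd" and j k
    by (simp add: vec_eq_iff add.commute)
  then show ?thesis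
    by (auto simp: commuting_tuple_def Mz_def fun_eq_iff axis_def)
qed

end

theory Submission
  imports Defs
begin

text \<open>
  The four conditions are proved in a cycle: weak homogeneity, uniform boundedness of the
  substitution operators \<open>C\<^sub>u\<close>, the bound on ratios of weights, similarity to a homogeneous
  \<open>M\<^sub>z\<close>, and back to weak homogeneity. Everything is decided degree by degree, because the
  homogeneous components are mutually orthogonal in \<open>H\<^sup>2(\<beta>)\<close> and \<open>C\<^sub>u\<close> respects them.

  \<^bold>\<open>From weak homogeneity to uniform boundedness.\<close> Let \<open>\<Gamma>\<close> intertwine \<open>M\<^sub>z\<close> and \<open>u \<cdot> M\<^sub>z\<close>
  and put \<open>g = \<Gamma> 1\<close>. Then \<open>\<Gamma> p = (C\<^sub>u p) g\<close> for polynomials \<open>p\<close>, so on homogeneous \<open>p\<close> the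
  component of \<open>\<Gamma> p\<close> of lowest degree is \<open>g(0) C\<^sub>u p\<close>
  (\<open>intertwiner_leading_term\<close>). Surjectivity of \<open>\<Gamma>\<close> forces \<open>g(0) \<noteq> 0\<close>, and each
  \<open>C\<^sub>u\<close> is bounded by \<open>\<parallel>\<Gamma>\<parallel> / \<bar>g(0)\<bar>\<close>. The group is compact, \<open>u \<mapsto> \<parallel>C\<^sub>u\<parallel>\<close> is a supremum of
  continuous functions, and norms are submultiplicative along the group law; Baire's theorem
  gives a bound near one point, and translations carry it over the whole group
  (\<open>uniform_degree_bound\<close>).

  \<^bold>\<open>From uniform boundedness to the ratio bound.\<close> With the Fock weights \<open>\<alpha>!\<close> in place of
  \<open>\<beta>\<^sub>\<alpha>\<^sup>2\<close> all \<open>C\<^sub>u\<close> are unitary, since multiplication by \<open>z\<^sub>j\<close> and differentiation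
  with respect to \<open>z\<^sub>j\<close> are adjoint to each other (\<open>fock_comp_op\<close>). Averaging over the whole
  unitary group would turn \<open>\<beta>\<^sup>2\<close> into an invariant weight, which in each degree is a
  multiple of \<open>\<alpha>!\<close>. Instead of Haar measure a discrete process is used. Fix one unitary \<open>v\<close>
  without zero entries. Replacing a weight \<open>x\<close> by the diagonal of the form
  \<open>f \<mapsto> \<parallel>C\<^sub>v f\<parallel>\<^sub>x\<^sup>2\<close> amounts to averaging over finitely many group elements, hence keeps all
  forms between constant multiples of the original one; on the quotients \<open>x\<^sub>\<alpha> / \<alpha>!\<close> it
  acts as a stochastic matrix with a strictly positive column, so iterating it drives the
  oscillation of \<open>x\<^sub>\<alpha> / \<alpha>!\<close> to zero. In the limit \<open>\<beta>\<^sub>\<alpha>\<^sup>2 / \<alpha>!\<close> is comparable to a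
  constant in each degree, with factors independent of the degree
  (\<open>weights_comparable\<close>).

  \<^bold>\<open>From the ratio bound to similarity.\<close> The weights \<open>m\<^sub>n \<surd>\<alpha>!\<close> for \<open>\<bar>\<alpha>\<bar> = n\<close>, where \<open>m\<^sub>n\<close>
  is one of the quotients \<open>\<beta>\<^sub>\<alpha> / \<surd>\<alpha>!\<close> in degree \<open>n\<close>, define an equivalent norm for
  which every \<open>C\<^sub>u\<close> is unitary, and \<open>C\<^sub>u\<close> is an intertwiner. Conjugating unitary intertwiners
  by a similarity gives bounded invertible ones, which closes the cycle.
\<close>

section \<open>Multi-indices and multiplication by the variables\<close>

text \<open>Unit vectors are written \<open>axis j 1\<close> throughout, so the numeral must not be rewritten.\<close>

declare One_nat_def [simp del]

lemma mlen_add_axis: "mlen (\<alpha> + axis j 1) = Suc (mlen \<alpha>)"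
  by (simp add: mlen_def axis_def sum.distrib)

lemma minus_axis_add: "\<alpha> $ j \<noteq> 0 \<Longrightarrow> \<alpha> - axis j 1 + axis j 1 = (\<alpha> :: nat ^ 'd)"
  by (auto simp: vec_eq_iff axis_def)

lemma mlen_minus_axis: "\<alpha> $ j \<noteq> 0 \<Longrightarrow> mlen \<alpha> = Suc n \<Longrightarrow> mlen (\<alpha> - axis j 1) = n"
  by (metis minus_axis_add mlen_add_axis nat.inject)

lemma mlen_eq_0: "mlen \<alpha> = 0 \<longleftrightarrow> \<alpha> = 0"
  by (auto simp: mlen_def vec_eq_iff)

lemma mfact_pos: "mfact \<alpha> > 0"
  by (simp add: mfact_def prod_pos)

lemma mfact_add_axis: "mfact (\<alpha> + axis j 1) = real (\<alpha> $ j + 1) * mfact \<alpha>"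
proof -
  have "mfact (\<alpha> + axis j 1) = (\<Prod>i\<in>UNIV. (if i = j then real (\<alpha> $ j + 1) else 1) * fact (\<alpha> $ i))"
    unfolding mfact_def by (intro prod.cong) (auto simp: axis_def One_nat_def)
  then show ?thesis
    by (simp add: prod.distrib mfact_def)
qed

text \<open>
  The reindexing behind every passage from degree \<open>n + 1\<close> to degree \<open>n\<close>: the nonzero
  coefficients of \<open>z\<^sub>j f\<close> in degree \<open>n + 1\<close> are the coefficients of \<open>f\<close> in degree \<open>n\<close>.
\<close>

lemma sum_mlen_shift:
  "(\<Sum>\<alpha> | mlen \<alpha> = Suc n. if \<alpha> $ j = 0 then 0 else G \<alpha>)
     = (\<Sum>\<alpha> | mlen \<alpha> = n. G (\<alpha> + axis j 1))"
proof -
  have "(\<Sum>\<alpha> | mlen \<alpha> = Suc n. if \<alpha> $ j = 0 then 0 else G \<alpha>)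
      = (\<Sum>\<alpha> | mlen \<alpha> = Suc n \<and> \<alpha> $ j \<noteq> 0. G \<alpha>)"
    by (intro sum.mono_neutral_cong_right) (auto simp: finite_mlen_eq)
  also have "\<dots> = (\<Sum>\<alpha> | mlen \<alpha> = n. G (\<alpha> + axis j 1))"
    by (rule sum.reindex_bij_witness[where i = "\<lambda>\<alpha>. \<alpha> + axis j 1" and j = "\<lambda>\<alpha>. \<alpha> - axis j 1"])
       (auto simp: minus_axis_add mlen_add_axis mlen_minus_axis)
  finally show ?thesis .
qed

lemma Mz_add_axis [simp]: "Mz j f (\<alpha> + axis j 1) = f \<alpha>"
  by (simp add: Mz_def)

lemma Mz_0 [simp]: "Mz j f 0 = 0"
  by (simp add: Mz_def)

lemma Mz_cong:
  assumes "\<And>\<alpha>. mlen \<gamma> = Suc (mlen \<alpha>) \<Longrightarrow> f \<alpha> = g \<alpha>"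
  shows "Mz j f \<gamma> = Mz j g \<gamma>"
proof (cases "\<gamma> $ j = 0")
  case False
  then have "f (\<gamma> - axis j 1) = g (\<gamma> - axis j 1)"
    by (intro assms) (metis minus_axis_add mlen_add_axis)
  then show ?thesis by (simp add: Mz_def)
qed (simp add: Mz_def)

lemma Mz_sum: "Mz j (\<lambda>\<alpha>. \<Sum>i\<in>A. f i \<alpha>) \<gamma> = (\<Sum>i\<in>A. Mz j (f i) \<gamma>)"
  by (simp add: Mz_def)

lemma Mz_scale: "Mz j (\<lambda>\<alpha>. c * f \<alpha>) \<gamma> = c * Mz j f \<gamma>"
  by (simp add: Mz_def)

section \<open>Differentiation and the Euler decomposition\<close>

definition pdiff :: "'d::finite \<Rightarrow> 'd pseries \<Rightarrow> 'd pseries"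
  where "pdiff j f = (\<lambda>\<alpha>. of_nat (\<alpha> $ j + 1) * f (\<alpha> + axis j 1))"

definition euler_part :: "'d::finite \<Rightarrow> 'd pseries \<Rightarrow> 'd pseries"
  where "euler_part j f = (\<lambda>\<alpha>. pdiff j f \<alpha> / of_nat (mlen \<alpha> + 1))"

text \<open>
  Euler's identity \<open>(\<Sum>j. z\<^sub>j \<partial>\<^sub>j f) = n f\<close> in degree \<open>n\<close>, solved for \<open>f\<close>. It writes a series
  canonically as its constant term plus multiples of the variables, which makes induction on the
  degree possible for arbitrary series, without a detour through monomials.
\<close>

lemma euler_decomposition:
  fixes f :: "'d::finite pseries"
  shows "f = (\<lambda>\<gamma>. f 0 * zmonom 0 \<gamma> + (\<Sum>j\<in>UNIV. Mz j (euler_part j f) \<gamma>))"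
proof
  fix \<gamma> :: "nat ^ 'd"
  show "f \<gamma> = f 0 * zmonom 0 \<gamma> + (\<Sum>j\<in>UNIV. Mz j (euler_part j f) \<gamma>)"
  proof (cases "\<gamma> = 0")
    case True
    then show ?thesis by (simp add: zmonom_def)
  next
    case False
    have "Mz j (euler_part j f) \<gamma> = of_nat (\<gamma> $ j) * (f \<gamma> / of_nat (mlen \<gamma>))" for j
    proof (cases "\<gamma> $ j = 0")
      case True
      then show ?thesis by (simp add: Mz_def)
    next
      case j: False
      then have len: "mlen (\<gamma> - axis j 1) + 1 = mlen \<gamma>"
        by (metis Suc_eq_plus1 minus_axis_add mlen_add_axis)
      have "Mz j (euler_part j f) \<gamma> = euler_part j f (\<gamma> - axis j 1)"
        using j by (simp add: Mz_def)
      also have "\<dots> = of_nat ((\<gamma> - axis j 1) $ j + 1) * f (\<gamma> - axis j 1 + axis j 1)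
          / of_nat (mlen (\<gamma> - axis j 1) + 1)"
        by (simp only: euler_part_def pdiff_def)
      also have "(\<gamma> - axis j 1) $ j + 1 = \<gamma> $ j"
        using j by (simp add: axis_def)
      finally show ?thesis
        unfolding len minus_axis_add[OF j] by simp
    qed
    then have "(\<Sum>j\<in>UNIV. Mz j (euler_part j f) \<gamma>) = of_nat (mlen \<gamma>) * (f \<gamma> / of_nat (mlen \<gamma>))"
      by (simp only: mlen_def of_nat_sum sum_distrib_right)
    moreover have "mlen \<gamma> \<noteq> 0"
      using False by (simp add: mlen_eq_0)
    ultimately show ?thesis
      using False by (simp add: zmonom_def)
  qed
qed

lemma pdiff_zmonom_0 [simp]: "pdiff j (zmonom 0) = (\<lambda>_. 0)"
proof -
  have "\<alpha> + axis j 1 \<noteq> 0" for \<alpha> :: "nat ^ 'a"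
    by (metis mlen_add_axis mlen_eq_0 nat.distinct(1))
  then show ?thesis by (auto simp: pdiff_def zmonom_def)
qed

lemma pdiff_add: "pdiff j (\<lambda>\<alpha>. f \<alpha> + g \<alpha>) \<gamma> = pdiff j f \<gamma> + pdiff j g \<gamma>"
  by (simp add: pdiff_def algebra_simps)

lemma pdiff_scale: "pdiff j (\<lambda>\<alpha>. c * f \<alpha>) \<gamma> = c * pdiff j f \<gamma>"
  by (simp add: pdiff_def)

lemma pdiff_sum: "pdiff j (\<lambda>\<alpha>. \<Sum>i\<in>A. f i \<alpha>) \<gamma> = (\<Sum>i\<in>A. pdiff j (f i) \<gamma>)"
  by (simp add: pdiff_def sum_distrib_left)

lemma pdiff_Mz: "pdiff j (Mz k f) \<gamma> = (if j = k then f \<gamma> else 0) + Mz k (pdiff j f) \<gamma>"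
proof (cases "j = k")
  case True
  have "pdiff k (Mz k f) \<gamma> = of_nat (\<gamma> $ k + 1) * f \<gamma>"
    by (simp add: pdiff_def)
  moreover have "Mz k (pdiff k f) \<gamma> = of_nat (\<gamma> $ k) * f \<gamma>"
  proof (cases "\<gamma> $ k = 0")
    case False
    then have "(\<gamma> - axis k 1) $ k + 1 = \<gamma> $ k" by (simp add: axis_def)
    then show ?thesis
      using False by (simp only: Mz_def pdiff_def minus_axis_add[OF False] if_False)
  qed (simp add: Mz_def)
  ultimately show ?thesis using True by (simp add: algebra_simps)
next
  case False
  have "\<gamma> $ k \<noteq> 0 \<Longrightarrow> \<gamma> + axis j 1 - axis k 1 = \<gamma> - axis k 1 + axis j 1"
    using False by (auto simp: vec_eq_iff axis_def)
  then show ?thesis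
    using False by (auto simp: pdiff_def Mz_def axis_def)
qed

section \<open>Algebra of the substitution operators\<close>

text \<open>
  On coefficients, multiplication by a variable in the polynomial ring is the shift \<open>Mz\<close>. This
  and \<open>subst_monom_add_axis\<close> below are what the rest needs to know about the polynomial ring.
\<close>

lemma lookup_single_axis_mult:
  fixes p :: "(nat ^ 'd::finite) \<Rightarrow>\<^sub>0 complex"
  shows "Poly_Mapping.lookup (Poly_Mapping.single (axis k 1) c * p) \<gamma>
    = c * Mz k (Poly_Mapping.lookup p) \<gamma>"
proof -
  have "(\<lambda>q. Poly_Mapping.lookup p q when \<gamma> = axis k 1 + q)
     = (\<lambda>q. if \<gamma> $ k = 0 then 0 else (Poly_Mapping.lookup p q when q = \<gamma> - axis k 1))"
  proof
    fix q
    have "\<gamma> = axis k 1 + q \<longleftrightarrow> \<gamma> $ k \<noteq> 0 \<and> q = \<gamma> - axis k 1"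
      by (metis add.commute minus_axis_add add_diff_cancel_left' vector_add_component axis_nth add_is_0 one_neq_zero)
    then show "(Poly_Mapping.lookup p q when \<gamma> = axis k 1 + q)
      = (if \<gamma> $ k = 0 then 0 else (Poly_Mapping.lookup p q when q = \<gamma> - axis k 1))"
      by (auto simp: when_def)
  qed
  then have "Sum_any (\<lambda>q. Poly_Mapping.lookup p q when \<gamma> = axis k 1 + q) = Mz k (Poly_Mapping.lookup p) \<gamma>"
    by (simp only: Mz_def) simp
  moreover have "Poly_Mapping.lookup (Poly_Mapping.single (axis k 1) c * p) \<gamma>
      = Sum_any (\<lambda>l :: nat ^ 'd. c * Sum_any (\<lambda>q. Poly_Mapping.lookup p q when \<gamma> = axis k 1 + q) when l = axis k 1)"
    unfolding lookup_mult prod_fun_def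
    by (rule arg_cong[where f = Sum_any]) (auto simp: lookup_single when_def)
  ultimately show ?thesis by simp
qed

lemma subst_monom_0: "Poly_Mapping.lookup (subst_monom u 0) = zmonom 0"
  by (simp add: subst_monom_def lookup_one zmonom_def when_def fun_eq_iff)

lemma subst_monom_add_axis:
  "Poly_Mapping.lookup (subst_monom u (\<alpha> + axis j 1)) \<gamma>
     = (\<Sum>k\<in>UNIV. u $ j $ k * Mz k (Poly_Mapping.lookup (subst_monom u \<alpha>)) \<gamma>)"
proof -
  let ?L = "\<lambda>i. \<Sum>k\<in>UNIV. Poly_Mapping.single (axis k 1) (u $ i $ k) :: (nat ^ 'a) \<Rightarrow>\<^sub>0 complex"
  have "(\<alpha> + axis j 1) $ i = (if i = j then \<alpha> $ i + 1 else \<alpha> $ i)" for i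
    by (simp add: axis_def)
  then have "subst_monom u (\<alpha> + axis j 1) = (\<Prod>i\<in>UNIV. (if i = j then ?L j else 1) * ?L i ^ (\<alpha> $ i))"
    unfolding subst_monom_def by (intro prod.cong) (auto simp: power_add)
  also have "\<dots> = ?L j * subst_monom u \<alpha>"
    by (simp add: prod.distrib subst_monom_def)
  finally show ?thesis
    by (simp add: sum_distrib_right lookup_sum lookup_single_axis_mult)
qed

lemma comp_op_add: "comp_op u (\<lambda>\<alpha>. f \<alpha> + g \<alpha>) \<gamma> = comp_op u f \<gamma> + comp_op u g \<gamma>"
  by (simp add: comp_op_def distrib_right sum.distrib)

lemma comp_op_scale: "comp_op u (\<lambda>\<alpha>. c * f \<alpha>) \<gamma> = c * comp_op u f \<gamma>"
  by (simp add: comp_op_def sum_distrib_left mult.assoc)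

lemma comp_op_sum: "comp_op u (\<lambda>\<alpha>. \<Sum>i\<in>A. f i \<alpha>) \<gamma> = (\<Sum>i\<in>A. comp_op u (f i) \<gamma>)"
  unfolding comp_op_def by (simp add: sum_distrib_right sum.swap[of _ A])

lemma comp_op_cong: "(\<And>\<alpha>. mlen \<alpha> = mlen \<gamma> \<Longrightarrow> f \<alpha> = g \<alpha>) \<Longrightarrow> comp_op u f \<gamma> = comp_op u g \<gamma>"
  by (simp add: comp_op_def)

lemma comp_op_at_0: "comp_op u f 0 = f 0"
  by (simp add: comp_op_def mlen_eq_0 mlen_def[of 0] subst_monom_0 zmonom_def)

text \<open>
  Multiplicativity of the substitution in the case of one variable factor:
  \<open>C\<^sub>u (z\<^sub>j f) = (u \<cdot> z)\<^sub>j C\<^sub>u f\<close>. It says that \<open>C\<^sub>u\<close> intertwines \<open>M\<^sub>z\<close> with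
  \<open>u \<cdot> M\<^sub>z\<close>, and together with the constant term it determines \<open>C\<^sub>u\<close>.
\<close>

lemma comp_op_Mz: "comp_op u (Mz j f) \<gamma> = (\<Sum>k\<in>UNIV. u $ j $ k * Mz k (comp_op u f) \<gamma>)"
proof (cases "mlen \<gamma>")
  case 0
  then show ?thesis by (simp add: mlen_eq_0 comp_op_at_0)
next
  case (Suc n)
  have "comp_op u (Mz j f) \<gamma> = (\<Sum>\<alpha> | mlen \<alpha> = Suc n. if \<alpha> $ j = 0 then 0 else
      Mz j f \<alpha> * Poly_Mapping.lookup (subst_monom u \<alpha>) \<gamma>)"
    unfolding comp_op_def Suc by (intro sum.cong) (auto simp: Mz_def)
  also have "\<dots> = (\<Sum>\<alpha> | mlen \<alpha> = n. f \<alpha> *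
      (\<Sum>k\<in>UNIV. u $ j $ k * Mz k (Poly_Mapping.lookup (subst_monom u \<alpha>)) \<gamma>))"
    unfolding sum_mlen_shift by (simp add: subst_monom_add_axis)
  also have "\<dots> = (\<Sum>k\<in>UNIV. u $ j $ k *
      (\<Sum>\<alpha> | mlen \<alpha> = n. f \<alpha> * Mz k (Poly_Mapping.lookup (subst_monom u \<alpha>)) \<gamma>))"
    by (simp add: sum_distrib_left sum.swap[of _ UNIV] mult.left_commute)
  also have "\<dots> = (\<Sum>k\<in>UNIV. u $ j $ k * Mz k (comp_op u f) \<gamma>)"
    using Suc by (intro sum.cong) (auto simp: Mz_def comp_op_def mlen_minus_axis)
  finally show ?thesis .
qed

text \<open>
  The recursion obtained by applying \<open>C\<^sub>u\<close> to the Euler decomposition. The right-hand side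
  involves \<open>C\<^sub>u\<close> only in degree one lower than that of \<open>\<gamma>\<close>.
\<close>

lemma comp_op_euler:
  "comp_op u f \<gamma> = f 0 * zmonom 0 \<gamma> +
     (\<Sum>j\<in>UNIV. \<Sum>k\<in>UNIV. u $ j $ k * Mz k (comp_op u (euler_part j f)) \<gamma>)"
proof -
  have one: "comp_op u (zmonom 0) \<gamma> = zmonom 0 \<gamma>"
  proof (cases "\<gamma> = 0")
    case True
    then show ?thesis by (simp add: comp_op_at_0)
  next
    case False
    then have "comp_op u (zmonom 0) \<gamma> = comp_op u (\<lambda>_. 0) \<gamma>"
      by (intro comp_op_cong) (auto simp: zmonom_def mlen_eq_0[symmetric])
    then show ?thesis
      using False by (simp add: comp_op_def zmonom_def)
  qed
  show ?thesis
    by (subst euler_decomposition[of f])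
       (simp add: comp_op_add comp_op_scale comp_op_sum comp_op_Mz one)
qed

text \<open>
  Substituting \<open>u \<cdot> z\<close> into \<open>f(v \<cdot> z)\<close> gives \<open>f(v \<cdot> (u \<cdot> z))\<close>, hence the reversed order.
\<close>

lemma comp_op_comp: "comp_op u (comp_op v f) \<gamma> = comp_op (v ** u) f \<gamma>"
proof (induction "mlen \<gamma>" arbitrary: f \<gamma>)
  case 0
  then show ?case by (simp add: mlen_eq_0 comp_op_at_0)
next
  case (Suc n)
  have "comp_op u (comp_op v f) \<gamma> = f 0 * comp_op u (zmonom 0) \<gamma> +
     (\<Sum>j\<in>UNIV. \<Sum>k\<in>UNIV. \<Sum>l\<in>UNIV. v $ j $ k * (u $ k $ l * Mz l (comp_op u (comp_op v (euler_part j f))) \<gamma>))"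
    by (subst comp_op_euler[abs_def])
       (simp add: comp_op_add comp_op_scale comp_op_sum comp_op_Mz sum_distrib_left)
  also have "comp_op u (zmonom 0) \<gamma> = zmonom 0 \<gamma>"
    using Suc(2) by (subst comp_op_cong[of _ _ "\<lambda>_. 0"]) (auto simp: zmonom_def mlen_eq_0[symmetric] comp_op_def mlen_def[of 0])
  also have "(\<Sum>j\<in>UNIV. \<Sum>k\<in>UNIV. \<Sum>l\<in>UNIV. v $ j $ k * (u $ k $ l * Mz l (comp_op u (comp_op v (euler_part j f))) \<gamma>))
     = (\<Sum>j\<in>UNIV. \<Sum>k\<in>UNIV. \<Sum>l\<in>UNIV. v $ j $ k * (u $ k $ l * Mz l (comp_op (v ** u) (euler_part j f)) \<gamma>))"
    using Suc by (intro sum.cong refl arg_cong2[where f = "(*)"] Mz_cong) auto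
  also have "\<dots> = (\<Sum>j\<in>UNIV. \<Sum>l\<in>UNIV. (v ** u) $ j $ l * Mz l (comp_op (v ** u) (euler_part j f)) \<gamma>)"
  proof (rule sum.cong[OF refl])
    fix j
    show "(\<Sum>k\<in>UNIV. \<Sum>l\<in>UNIV. v $ j $ k * (u $ k $ l * Mz l (comp_op (v ** u) (euler_part j f)) \<gamma>))
      = (\<Sum>l\<in>UNIV. (v ** u) $ j $ l * Mz l (comp_op (v ** u) (euler_part j f)) \<gamma>)"
      by (subst sum.swap) (simp add: matrix_matrix_mult_def sum_distrib_right mult.assoc)
  qed
  finally show ?case
    unfolding comp_op_euler[of "v ** u" f \<gamma>, symmetric] .
qed

lemma comp_op_diag:
  "comp_op (\<chi> i k. if i = k then t i else 0) f \<gamma> = (\<Prod>j\<in>UNIV. t j ^ (\<gamma> $ j)) * f \<gamma>"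
proof (induction "mlen \<gamma>" arbitrary: f \<gamma>)
  case 0
  then show ?case by (simp add: mlen_eq_0 comp_op_at_0)
next
  case (Suc n)
  let ?u = "(\<chi> i k. if i = k then t i else 0)" and ?t = "\<lambda>\<gamma>. \<Prod>j\<in>UNIV. t j ^ (\<gamma> $ j)"
  have t: "?t (\<alpha> + axis k 1) = t k * ?t \<alpha>" for \<alpha> :: "nat ^ 'a" and k
  proof -
    have "?t (\<alpha> + axis k 1) = (\<Prod>j\<in>UNIV. (if j = k then t k else 1) * t j ^ (\<alpha> $ j))"
      by (intro prod.cong) (auto simp: axis_def power_add)
    then show ?thesis by (simp add: prod.distrib)
  qed
  have z: "zmonom 0 \<gamma> = 0" using Suc(2) by (auto simp: zmonom_def mlen_def)
  have "comp_op ?u f \<gamma> = (\<Sum>j\<in>UNIV. \<Sum>k\<in>UNIV. if k = j then t j * Mz j (comp_op ?u (euler_part j f)) \<gamma> else 0)"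
    by (subst comp_op_euler) (simp add: z if_distrib[of "\<lambda>x. x * _"] cong: if_cong)
  also have "\<dots> = (\<Sum>j\<in>UNIV. t j * Mz j (comp_op ?u (euler_part j f)) \<gamma>)"
    by simp
  also have "\<dots> = (\<Sum>j\<in>UNIV. t j * Mz j (\<lambda>\<alpha>. ?t \<alpha> * euler_part j f \<alpha>) \<gamma>)"
    using Suc by (intro sum.cong refl arg_cong2[where f = "(*)"] Mz_cong) auto
  also have "\<dots> = (\<Sum>j\<in>UNIV. ?t \<gamma> * Mz j (euler_part j f) \<gamma>)"
  proof (intro sum.cong refl)
    fix j
    show "t j * Mz j (\<lambda>\<alpha>. ?t \<alpha> * euler_part j f \<alpha>) \<gamma> = ?t \<gamma> * Mz j (euler_part j f) \<gamma>"
      using t[of "\<gamma> - axis j 1" j] by (cases "\<gamma> $ j = 0") (auto simp: minus_axis_add Mz_def)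
  qed
  also have "\<dots> = ?t \<gamma> * f \<gamma>"
  proof -
    have "f \<gamma> = (\<Sum>j\<in>UNIV. Mz j (euler_part j f) \<gamma>)"
      by (rule trans[OF fun_cong[OF euler_decomposition]]) (simp add: z)
    then show ?thesis by (simp only: sum_distrib_left)
  qed
  finally show ?case .
qed

lemma comp_op_mat_1: "comp_op (mat 1) f = f"
  using comp_op_diag[of "\<lambda>_. 1" f] by (simp add: fun_eq_iff mat_def)

text \<open>
  The chain rule. The transposed indices \<open>u\<^sub>l\<^sub>j\<close>, against \<open>u\<^sub>j\<^sub>k\<close> in \<open>comp_op_Mz\<close>, are what
  turns the rows of \<open>u\<close> into the orthogonality relations in \<open>fock_comp_op\<close>.
\<close>

lemma pdiff_comp_op:
  "pdiff j (comp_op u f) \<gamma> = (\<Sum>l\<in>UNIV. u $ l $ j * comp_op u (pdiff l f) \<gamma>)"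
proof (induction "mlen \<gamma>" arbitrary: f \<gamma> rule: less_induct)
  case less
  let ?h = "\<lambda>i. euler_part i f"
  have "pdiff j (comp_op u f) \<gamma> = (\<Sum>i\<in>UNIV. \<Sum>k\<in>UNIV. u $ i $ k * pdiff j (Mz k (comp_op u (?h i))) \<gamma>)"
    by (subst comp_op_euler[abs_def]) (simp add: pdiff_add pdiff_scale pdiff_sum)
  also have "\<dots> = (\<Sum>i\<in>UNIV. u $ i $ j * comp_op u (?h i) \<gamma>
      + (\<Sum>k\<in>UNIV. u $ i $ k * Mz k (pdiff j (comp_op u (?h i))) \<gamma>))"
    by (intro sum.cong refl)
       (simp add: pdiff_Mz distrib_left sum.distrib if_distrib[of "\<lambda>x. _ * x"] cong: if_cong)
  also have "\<dots> = (\<Sum>i\<in>UNIV. u $ i $ j * comp_op u (?h i) \<gamma>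
      + (\<Sum>k\<in>UNIV. u $ i $ k * Mz k (\<lambda>\<alpha>. \<Sum>l\<in>UNIV. u $ l $ j * comp_op u (pdiff l (?h i)) \<alpha>) \<gamma>))"
    using less by (intro sum.cong refl arg_cong2[where f = "(*)"] arg_cong2[where f = "(+)"] Mz_cong) auto
  also have "\<dots> = (\<Sum>i\<in>UNIV. u $ i $ j * comp_op u (?h i) \<gamma>)
      + (\<Sum>i\<in>UNIV. \<Sum>k\<in>UNIV. \<Sum>l\<in>UNIV. u $ l $ j * (u $ i $ k * Mz k (comp_op u (pdiff l (?h i))) \<gamma>))"
    by (simp add: sum.distrib Mz_sum Mz_scale sum_distrib_left mult.left_commute)
  also have "(\<Sum>i\<in>UNIV. \<Sum>k\<in>UNIV. \<Sum>l\<in>UNIV. u $ l $ j * (u $ i $ k * Mz k (comp_op u (pdiff l (?h i))) \<gamma>))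
     = (\<Sum>i\<in>UNIV. \<Sum>l\<in>UNIV. u $ l $ j * comp_op u (Mz i (pdiff l (?h i))) \<gamma>)"
    unfolding comp_op_Mz sum_distrib_left by (rule sum.cong[OF refl], rule sum.swap)
  also have "\<dots> = (\<Sum>l\<in>UNIV. u $ l $ j * (\<Sum>i\<in>UNIV. comp_op u (Mz i (pdiff l (?h i))) \<gamma>))"
    unfolding sum_distrib_left by (rule sum.swap)
  also have "(\<Sum>i\<in>UNIV. u $ i $ j * comp_op u (?h i) \<gamma>) + \<dots>
     = (\<Sum>l\<in>UNIV. u $ l $ j * (comp_op u (?h l) \<gamma> + (\<Sum>i\<in>UNIV. comp_op u (Mz i (pdiff l (?h i))) \<gamma>)))"
    by (simp add: sum.distrib distrib_left)
  also have "\<dots> = (\<Sum>l\<in>UNIV. u $ l $ j * comp_op u (pdiff l f) \<gamma>)"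
  proof (intro sum.cong refl arg_cong2[where f = "(*)"])
    fix l
    have "pdiff l f = (\<lambda>\<alpha>. ?h l \<alpha> + (\<Sum>i\<in>UNIV. Mz i (pdiff l (?h i)) \<alpha>))"
    proof
      fix \<alpha>
      show "pdiff l f \<alpha> = ?h l \<alpha> + (\<Sum>i\<in>UNIV. Mz i (pdiff l (?h i)) \<alpha>)"
        using arg_cong[OF euler_decomposition[of f], of "\<lambda>g. pdiff l g \<alpha>"]
        by (simp add: pdiff_add pdiff_scale pdiff_sum pdiff_Mz sum.distrib)
    qed
    then show "comp_op u (?h l) \<gamma> + (\<Sum>i\<in>UNIV. comp_op u (Mz i (pdiff l (?h i))) \<gamma>) = comp_op u (pdiff l f) \<gamma>"
      by (simp add: comp_op_add comp_op_sum)
  qed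
  finally show ?case .
qed

section \<open>The Fock form and its unitary invariance\<close>

text \<open>
  The part of degree \<open>n\<close> of the Bargmann--Fock inner product, in which the norm of \<open>z\<^sup>\<alpha>\<close> is
  \<open>\<surd>\<alpha>!\<close>.
\<close>

definition fock :: "nat \<Rightarrow> 'd::finite pseries \<Rightarrow> 'd pseries \<Rightarrow> complex"
  where "fock n f g = (\<Sum>\<alpha> | mlen \<alpha> = n. of_real (mfact \<alpha>) * (f \<alpha> * cnj (g \<alpha>)))"

lemma fock_sum_left: "fock n (\<lambda>\<alpha>. \<Sum>i\<in>A. f i \<alpha>) g = (\<Sum>i\<in>A. fock n (f i) g)"
  unfolding fock_def by (simp add: sum_distrib_right sum_distrib_left sum.swap[of _ A])

lemma fock_sum_right: "fock n f (\<lambda>\<alpha>. \<Sum>i\<in>A. g i \<alpha>) = (\<Sum>i\<in>A. fock n f (g i))"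
  unfolding fock_def by (simp add: sum_distrib_left sum.swap[of _ A])

lemma fock_scale_left: "fock n (\<lambda>\<alpha>. c * f \<alpha>) g = c * fock n f g"
  unfolding fock_def by (simp add: sum_distrib_left algebra_simps)

lemma fock_scale_right: "fock n f (\<lambda>\<alpha>. c * g \<alpha>) = cnj c * fock n f g"
  unfolding fock_def by (simp add: sum_distrib_left algebra_simps)

lemma fock_cong: "(\<And>\<alpha>. mlen \<alpha> = n \<Longrightarrow> f \<alpha> = f' \<alpha>) \<Longrightarrow> fock n f g = fock n f' g"
  by (simp add: fock_def)

text \<open>
  The weights \<open>\<alpha>!\<close> are exactly those for which \<open>z\<^sub>j\<close> and \<open>\<partial>\<^sub>j\<close> are adjoint to each other.
\<close>

lemma fock_Mz: "fock (Suc n) (Mz j f) g = fock n f (pdiff j g)"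
proof -
  have "fock (Suc n) (Mz j f) g = (\<Sum>\<alpha> | mlen \<alpha> = Suc n. if \<alpha> $ j = 0 then 0 else
      of_real (mfact \<alpha>) * (Mz j f \<alpha> * cnj (g \<alpha>)))"
    unfolding fock_def by (intro sum.cong) (auto simp: Mz_def)
  then show ?thesis
    unfolding sum_mlen_shift
    by (simp add: fock_def pdiff_def mfact_add_axis algebra_simps del: of_nat_Suc)
qed

lemma unitary_rows:
  assumes "u \<in> unitary_group"
  shows "(\<Sum>k\<in>UNIV. u $ j $ k * cnj (u $ l $ k)) = (if j = l then 1 else 0)"
proof -
  have "(u ** (\<chi> i j. cnj (u $ j $ i))) $ j $ l = mat 1 $ j $ l"
    using assms by (simp add: unitary_group_def)
  then show ?thesis by (simp add: matrix_matrix_mult_def mat_def)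
qed

text \<open>
  Induction on the degree: in \<open>\<langle>C\<^sub>u (z\<^sub>j h), C\<^sub>u g\<rangle>\<close> the factor \<open>(u \<cdot> z)\<^sub>j\<close> is moved to the other
  side as a combination of derivatives, and the chain rule produces \<open>u u\<^sup>*\<close>, the identity.
\<close>

theorem fock_comp_op:
  assumes "u \<in> unitary_group"
  shows "fock n (comp_op u f) (comp_op u g) = fock n f g"
proof (induction n arbitrary: f g)
  case 0
  have "{\<alpha>. mlen \<alpha> = 0} = {0 :: nat ^ 'a}" by (auto simp: mlen_eq_0)
  then show ?case by (simp add: fock_def comp_op_at_0)
next
  case (Suc n)
  let ?h = "\<lambda>j. euler_part j f"
  have z: "zmonom 0 \<alpha> = 0" if "mlen \<alpha> = Suc n" for \<alpha> :: "nat ^ 'a"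
    using that by (auto simp: zmonom_def mlen_def)
  have "fock (Suc n) (comp_op u f) (comp_op u g) =
      fock (Suc n) (\<lambda>\<gamma>. \<Sum>j\<in>UNIV. \<Sum>k\<in>UNIV. u $ j $ k * Mz k (comp_op u (?h j)) \<gamma>) (comp_op u g)"
    by (rule fock_cong) (subst comp_op_euler, simp add: z)
  also have "\<dots> = (\<Sum>j\<in>UNIV. \<Sum>k\<in>UNIV. u $ j $ k * fock n (comp_op u (?h j)) (pdiff k (comp_op u g)))"
    by (simp add: fock_sum_left fock_scale_left fock_Mz)
  also have "\<dots> = (\<Sum>j\<in>UNIV. \<Sum>k\<in>UNIV. \<Sum>l\<in>UNIV.
      (u $ j $ k * cnj (u $ l $ k)) * fock n (comp_op u (?h j)) (comp_op u (pdiff l g)))"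
    by (simp add: pdiff_comp_op[abs_def] fock_sum_right fock_scale_right sum_distrib_left mult.assoc)
  also have "\<dots> = (\<Sum>j\<in>UNIV. \<Sum>k\<in>UNIV. \<Sum>l\<in>UNIV.
      (u $ j $ k * cnj (u $ l $ k)) * fock n (?h j) (pdiff l g))"
    by (simp add: Suc)
  also have "\<dots> = (\<Sum>j\<in>UNIV. \<Sum>l\<in>UNIV.
      (\<Sum>k\<in>UNIV. u $ j $ k * cnj (u $ l $ k)) * fock n (?h j) (pdiff l g))"
    unfolding sum_distrib_right by (rule sum.cong[OF refl], rule sum.swap)
  also have "\<dots> = (\<Sum>j\<in>UNIV. \<Sum>l\<in>UNIV. if j = l then fock n (?h j) (pdiff l g) else 0)"
    unfolding unitary_rows[OF assms] by (intro sum.cong) auto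
  also have "\<dots> = (\<Sum>j\<in>UNIV. fock (Suc n) (Mz j (?h j)) g)"
    by (simp add: fock_Mz)
  also have "\<dots> = fock (Suc n) f g"
    unfolding fock_sum_left[symmetric]
    by (rule fock_cong) (rule trans[OF _ fun_cong[OF euler_decomposition, symmetric]], simp add: z)
  finally show ?case .
qed

text \<open>
  The square of the norm with weights \<open>w\<close> (squares of norms of monomials) of the component of
  degree \<open>n\<close>. The weight is a parameter because the averaging process changes it.
\<close>

definition degform :: "(nat ^ 'd::finite \<Rightarrow> real) \<Rightarrow> nat \<Rightarrow> 'd pseries \<Rightarrow> real"
  where "degform w n f = (\<Sum>\<alpha> | mlen \<alpha> = n. w \<alpha> * (cmod (f \<alpha>))\<^sup>2)"

lemma degform_nonneg: "(\<And>\<alpha>. w \<alpha> \<ge> 0) \<Longrightarrow> degform w n f \<ge> 0"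
  by (simp add: degform_def sum_nonneg)

lemma degform_zmonom: "mlen \<alpha> = n \<Longrightarrow> degform w n (zmonom \<alpha>) = w \<alpha>"
  by (simp add: degform_def zmonom_def if_distrib[of cmod] if_distrib[of "\<lambda>x. x ^ 2"]
      if_distrib[of "\<lambda>x. _ * x"] finite_mlen_eq cong: if_cong)

lemma degform_cong: "(\<And>\<alpha>. mlen \<alpha> = n \<Longrightarrow> f \<alpha> = g \<alpha>) \<Longrightarrow> degform w n f = degform w n g"
  by (simp add: degform_def)

lemma of_real_cmod_square: "(complex_of_real (cmod z))\<^sup>2 = z * cnj z"
  using complex_norm_square[of z] by simp

lemma degform_mfact: "of_real (degform mfact n f) = fock n f f"
  by (simp add: degform_def fock_def of_real_cmod_square)

lemma degform_mfact_comp_op: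
  "u \<in> unitary_group \<Longrightarrow> degform mfact n (comp_op u f) = degform mfact n f"
  using fock_comp_op[of u n f f] by (simp flip: degform_mfact)

section \<open>Unitary matrices\<close>

definition mat_adjoint :: "complex ^ 'd ^ 'd::finite \<Rightarrow> complex ^ 'd ^ 'd"
  where "mat_adjoint u = (\<chi> i j. cnj (u $ j $ i))"

lemma unitary_iff: "u \<in> unitary_group \<longleftrightarrow> u ** mat_adjoint u = mat 1 \<and> mat_adjoint u ** u = mat 1"
  by (simp add: unitary_group_def mat_adjoint_def)

lemma mat_adjoint_twice [simp]: "mat_adjoint (mat_adjoint u) = u"
  by (simp add: mat_adjoint_def vec_eq_iff)

lemma mat_adjoint_mult: "mat_adjoint (u ** v) = mat_adjoint v ** mat_adjoint u"
  by (simp add: mat_adjoint_def vec_eq_iff matrix_matrix_mult_def mult.commute)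

lemma unitary_adj: "u \<in> unitary_group \<Longrightarrow> mat_adjoint u \<in> unitary_group"
  by (simp add: unitary_iff)

lemma unitary_one: "mat 1 \<in> unitary_group"
proof -
  have "mat_adjoint (mat 1) = mat 1" by (auto simp: mat_adjoint_def vec_eq_iff mat_def)
  then show ?thesis by (simp add: unitary_iff)
qed

lemma unitary_mult: "u \<in> unitary_group \<Longrightarrow> v \<in> unitary_group \<Longrightarrow> u ** v \<in> unitary_group"
  unfolding unitary_iff mat_adjoint_mult by (metis matrix_mul_assoc matrix_mul_rid)

text \<open>
  Every \<open>C\<^sub>u\<close> with unitary \<open>u\<close> is invertible, so an upper bound for the inverse is a lower bound
  for \<open>C\<^sub>u\<close>.
\<close>

lemma comp_op_adj:
  assumes "u \<in> unitary_group"
  shows "comp_op u (comp_op (mat_adjoint u) f) = f" "comp_op (mat_adjoint u) (comp_op u f) = f"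
  using assms by (simp_all add: fun_eq_iff comp_op_comp unitary_iff comp_op_mat_1)

lemma unitary_diag:
  assumes "\<And>i. cmod (t i) = 1"
  shows "(\<chi> i k. if i = k then t i else 0) \<in> unitary_group"
proof -
  have "t i * cnj (t i) = 1" for i
    using assms by (simp add: complex_norm_square[symmetric])
  then show ?thesis
    by (auto simp: unitary_iff mat_adjoint_def vec_eq_iff matrix_matrix_mult_def mat_def mult.commute
        if_distrib[of cnj] if_distrib[of "\<lambda>x. x * _"] if_distrib[of "\<lambda>x. _ * x"] cong: if_cong)
qed

text \<open>
  A rank-one perturbation of the identity: \<open>u = 1 + (\<i> - 1) E\<close>, where \<open>E\<close> is the projection
  onto the constant vectors, has its eigenvalues among \<open>1\<close> and \<open>\<i>\<close>. Its diagonal entries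
  are \<open>(d - 1 + \<i>) / d\<close> and the other entries are \<open>(\<i> - 1) / d\<close>.
\<close>

lemma unitary_full_exists: "\<exists>u \<in> unitary_group. \<forall>i j. (u :: complex ^ 'd ^ 'd::finite) $ i $ j \<noteq> 0"
proof -
  \<comment> \<open>The entry \<open>c\<close> satisfies \<open>c + c\<^sup>* + d c c\<^sup>* = 0\<close>, which is the unitarity of \<open>1 + c J\<close> for the all-ones matrix \<open>J\<close>.\<close>
  define d where "d = real CARD('d)"
  define c where "c = (\<i> - 1) / complex_of_real d"
  define u :: "complex ^ 'd ^ 'd" where "u = (\<chi> i j. (if i = j then 1 else 0) + c)"
  have d: "d > 0" by (simp add: d_def)
  have c: "c + cnj c + d * (c * cnj c) = 0"
    using d by (simp add: c_def field_simps)
  have c': "cnj c + c + d * (cnj c * c) = 0"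
    using c by (simp add: algebra_simps)
  have "c \<noteq> 0" using d by (auto simp: c_def complex_eq_iff)
  moreover have "1 + c \<noteq> 0" using d by (auto simp: c_def complex_eq_iff field_simps)
  ultimately have "\<forall>i j. u $ i $ j \<noteq> 0" by (simp add: u_def)
  moreover have "u ** mat_adjoint u = mat 1"
  proof -
    have "(u ** mat_adjoint u) $ i $ j = mat 1 $ i $ j" for i j
    proof -
      have "(u ** mat_adjoint u) $ i $ j = (\<Sum>k\<in>UNIV. (if k = i then (if k = j then 1 else 0) + cnj c else 0)
          + ((if k = j then c else 0) + c * cnj c))"
        by (auto simp: u_def mat_adjoint_def matrix_matrix_mult_def algebra_simps intro!: sum.cong)
      also have "\<dots> = (if i = j then 1 else 0) + (c + cnj c + d * (c * cnj c))"
        by (simp add: sum.distrib d_def)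
      finally show ?thesis using c by (simp add: mat_def)
    qed
    then show ?thesis by (simp add: vec_eq_iff)
  qed
  moreover have "mat_adjoint u ** u = mat 1"
  proof -
    have "(mat_adjoint u ** u) $ i $ j = mat 1 $ i $ j" for i j
    proof -
      have "(mat_adjoint u ** u) $ i $ j = (\<Sum>k\<in>UNIV. (if k = i then (if k = j then 1 else 0) + c else 0)
          + ((if k = j then cnj c else 0) + cnj c * c))"
        by (auto simp: u_def mat_adjoint_def matrix_matrix_mult_def algebra_simps intro!: sum.cong)
      also have "\<dots> = (if i = j then 1 else 0) + (cnj c + c + d * (cnj c * c))"
        by (simp add: sum.distrib d_def)
      finally show ?thesis using c' by (simp add: mat_def)
    qed
    then show ?thesis by (simp add: vec_eq_iff)
  qed
  ultimately have "u \<in> unitary_group" "\<forall>i j. u $ i $ j \<noteq> 0" by (simp_all add: unitary_iff)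
  then show ?thesis by blast
qed

section \<open>Averaging over the diagonal torus\<close>

lemma zmonom_add_axis: "zmonom (\<alpha> + axis i 1) = Mz i (zmonom \<alpha>)"
proof
  fix \<gamma>
  show "zmonom (\<alpha> + axis i 1) \<gamma> = Mz i (zmonom \<alpha>) \<gamma>"
  proof (cases "\<gamma> $ i = 0")
    case True
    then have "\<gamma> \<noteq> \<alpha> + axis i 1" by (auto simp: axis_def)
    then show ?thesis using True by (simp add: Mz_def zmonom_def)
  next
    case False
    then have "\<gamma> = \<alpha> + axis i 1 \<longleftrightarrow> \<gamma> - axis i 1 = \<alpha>"
      by (metis minus_axis_add add_diff_cancel_right')
    then show ?thesis using False by (simp add: Mz_def zmonom_def)
  qed
qed

text \<open>
  The coefficient of \<open>z\<^sub>j\<^sup>n\<close> in \<open>(u \<cdot> z)\<^sup>\<alpha>\<close> is \<open>\<Prod>i. u\<^sub>i\<^sub>j\<^bsup>\<alpha>\<^sub>i\<^esup>\<close>, as one sees by putting the other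
  variables equal to zero.
\<close>

lemma comp_op_zmonom_axis_nonzero:
  assumes "\<And>i. u $ i $ j \<noteq> 0"
  shows "mlen \<alpha> = n \<Longrightarrow> comp_op u (zmonom \<alpha>) (axis j n) \<noteq> 0"
proof (induction n arbitrary: \<alpha>)
  case 0
  have "axis j 0 = (0 :: nat ^ 'a)" by (simp add: vec_eq_iff axis_def)
  then show ?case using 0 by (simp only: comp_op_at_0) (simp add: mlen_eq_0 zmonom_def)
next
  case (Suc n)
  then have "\<alpha> \<noteq> 0" using mlen_eq_0[of \<alpha>] by simp
  then obtain i where i: "\<alpha> $ i \<noteq> 0" by (auto simp: vec_eq_iff)
  define \<delta> where "\<delta> = \<alpha> - axis i 1"
  have \<delta>: "\<alpha> = \<delta> + axis i 1" "mlen \<delta> = n"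
    using i Suc.prems by (simp_all add: \<delta>_def minus_axis_add mlen_minus_axis)
  have ax: "axis j (Suc n) - axis j 1 = (axis j n :: nat ^ 'a)"
    by (simp add: vec_eq_iff axis_def)
  have "comp_op u (zmonom \<alpha>) (axis j (Suc n))
      = (\<Sum>k\<in>UNIV. u $ i $ k * Mz k (comp_op u (zmonom \<delta>)) (axis j (Suc n)))"
    by (simp add: \<delta> zmonom_add_axis comp_op_Mz)
  also have "\<dots> = (\<Sum>k\<in>UNIV. if k = j then u $ i $ j * comp_op u (zmonom \<delta>) (axis j n) else 0)"
    by (intro sum.cong) (auto simp: Mz_def ax, auto simp: axis_def)
  finally show ?case using assms Suc.IH[OF \<delta>(2)] by simp
qed

lemma mlen_component_le: "\<alpha> $ j \<le> mlen \<alpha>"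
  unfolding mlen_def using member_le_sum[of j UNIV "\<lambda>j. \<alpha> $ j"] by auto

text \<open>
  The diagonal matrices whose entries are roots of unity of order \<open>n + 1\<close> form a finite subgroup
  of the torus that already separates the characters \<open>t\<^sup>\<alpha>\<close> with \<open>\<bar>\<alpha>\<bar> = n\<close>, because the
  exponents lie in \<open>{0..n}\<close>.
\<close>

lemma torus_orthogonality:
  obtains T :: "('d::finite \<Rightarrow> complex) set" where
    "finite T" "T \<noteq> {}" "\<And>t i. t \<in> T \<Longrightarrow> cmod (t i) = 1"
    "\<And>\<alpha> \<delta> :: nat ^ 'd. mlen \<alpha> = n \<Longrightarrow> mlen \<delta> = n \<Longrightarrow>
       (\<Sum>t\<in>T. (\<Prod>j\<in>UNIV. t j ^ (\<alpha> $ j)) * cnj (\<Prod>j\<in>UNIV. t j ^ (\<delta> $ j)))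
         = (if \<alpha> = \<delta> then of_nat (card T) else 0)"
proof
  define R where "R = {z :: complex. z ^ Suc n = 1}"
  have cR: "card R = Suc n" unfolding R_def by (rule card_roots_unity_eq) simp
  have fR: "finite R" using cR by (metis card.infinite nat.distinct(1))
  have nR: "R \<noteq> {}" using cR by auto
  have norm: "cmod z = 1" if "z \<in> R" for z
    using that power_eq_1_iff[of z "Suc n"] by (simp add: R_def)
  define T :: "('d \<Rightarrow> complex) set" where "T = PiE UNIV (\<lambda>_. R)"
  show "finite T" by (simp add: T_def fR finite_PiE)
  show "T \<noteq> {}" using nR by (simp add: T_def PiE_eq_empty_iff)
  show "cmod (t i) = 1" if "t \<in> T" for t i using that norm by (auto simp: T_def)
  have unit: "z ^ a * cnj (z ^ a) = 1" if "z \<in> R" for z a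
  proof -
    have "z * cnj z = 1" using norm[OF that] by (simp add: of_real_cmod_square[symmetric])
    then have "(z * cnj z) ^ a = 1" by simp
    then show ?thesis by (simp add: power_mult_distrib)
  qed
  have orth: "(\<Sum>z\<in>R. z ^ a * cnj (z ^ b)) = (if a = b then of_nat (Suc n) else 0)"
    if "a \<le> n" "b \<le> n" for a b
  proof (cases "a = b")
    case True
    then show ?thesis using unit cR by simp
  next
    case False
    define \<omega> where "\<omega> = exp (2 * of_real pi * \<i> / of_nat (Suc n))"
    have \<omega>: "\<omega> ^ k = exp (2 * of_real pi * \<i> * of_nat k / of_nat (Suc n))" for k
      unfolding \<omega>_def exp_of_nat_mult[symmetric] by (simp add: algebra_simps)
    have "\<omega> ^ Suc n = 1" unfolding \<omega> by (simp del: of_nat_Suc)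
    then have \<omega>R: "\<omega> \<in> R" by (simp add: R_def)
    have "\<omega> ^ a \<noteq> \<omega> ^ b"
      using complex_root_unity_eq[of "Suc n" a b] that False unfolding \<omega>
      by (simp add: cong_def del: of_nat_Suc)
    moreover have "\<omega> ^ b * cnj (\<omega> ^ b) = 1" by (rule unit[OF \<omega>R])
    ultimately have ne: "\<omega> ^ a * cnj (\<omega> ^ b) \<noteq> 1"
      by (metis mult.commute mult.left_commute mult.right_neutral)
    \<comment> \<open>Translation by \<open>\<omega>\<close> permutes the roots and multiplies the sum by a factor other than \<open>1\<close>.\<close>
    have "(\<Sum>z\<in>R. z ^ a * cnj (z ^ b)) = (\<Sum>z\<in>R. (\<omega> * z) ^ a * cnj ((\<omega> * z) ^ b))"
    proof (rule sum.reindex_bij_betw[symmetric])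
      have inj: "inj_on ((*) \<omega>) R"
        using norm[OF \<omega>R] by (auto simp: inj_on_def)
      have "(*) \<omega> ` R \<subseteq> R"
        using \<omega>R unfolding R_def by (auto simp: power_mult_distrib simp del: power_Suc)
      then show "bij_betw ((*) \<omega>) R R"
        using inj fR by (simp add: bij_betw_def endo_inj_surj)
    qed
    also have "\<dots> = (\<omega> ^ a * cnj (\<omega> ^ b)) * (\<Sum>z\<in>R. z ^ a * cnj (z ^ b))"
      by (simp add: sum_distrib_left power_mult_distrib mult_ac)
    finally show ?thesis using ne False by simp
  qed
  fix \<alpha> \<delta> :: "nat ^ 'd" assume len: "mlen \<alpha> = n" "mlen \<delta> = n"
  have "(\<Sum>t\<in>T. (\<Prod>j\<in>UNIV. t j ^ (\<alpha> $ j)) * cnj (\<Prod>j\<in>UNIV. t j ^ (\<delta> $ j)))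
      = (\<Sum>t\<in>T. \<Prod>j\<in>UNIV. t j ^ (\<alpha> $ j) * cnj (t j ^ (\<delta> $ j)))"
    by (simp add: prod.distrib)
  also have "\<dots> = (\<Prod>j\<in>UNIV. \<Sum>z\<in>R. z ^ (\<alpha> $ j) * cnj (z ^ (\<delta> $ j)))"
    unfolding T_def by (rule prod_sum_PiE[symmetric]) (auto simp: fR)
  also have "\<dots> = (\<Prod>j\<in>UNIV. if \<alpha> $ j = \<delta> $ j then of_nat (Suc n) else 0)"
    using len mlen_component_le by (intro prod.cong orth) (auto, metis+)
  also have "\<dots> = (if \<alpha> = \<delta> then of_nat (card T) else 0)"
    by (auto simp: T_def card_PiE cR vec_eq_iff simp del: of_nat_Suc)
  finally show "(\<Sum>t\<in>T. (\<Prod>j\<in>UNIV. t j ^ (\<alpha> $ j)) * cnj (\<Prod>j\<in>UNIV. t j ^ (\<delta> $ j)))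
         = (if \<alpha> = \<delta> then of_nat (card T) else 0)" .
qed

lemma comp_op_zmonom_expand:
  "comp_op u f \<gamma> = (\<Sum>\<alpha> | mlen \<alpha> = mlen \<gamma>. f \<alpha> * comp_op u (zmonom \<alpha>) \<gamma>)"
proof -
  have "comp_op u (zmonom \<alpha>) \<gamma> = Poly_Mapping.lookup (subst_monom u \<alpha>) \<gamma>" if "mlen \<alpha> = mlen \<gamma>" for \<alpha>
    using that by (simp add: comp_op_def zmonom_def if_distrib[of "\<lambda>x. x * _"] finite_mlen_eq cong: if_cong)
  then show ?thesis by (simp add: comp_op_def)
qed

text \<open>
  Averaging a quadratic form over the torus removes its off-diagonal terms, so the average of
  \<open>f \<mapsto> \<parallel>C\<^sub>u f\<parallel>\<^sub>x\<^sup>2\<close> is again of the diagonal type \<open>degform\<close>.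
\<close>

lemma torus_average:
  assumes T: "finite T" "\<And>\<alpha> \<delta> :: nat ^ 'd::finite. mlen \<alpha> = n \<Longrightarrow> mlen \<delta> = n \<Longrightarrow>
       (\<Sum>t\<in>T. (\<Prod>j\<in>UNIV. t j ^ (\<alpha> $ j)) * cnj (\<Prod>j\<in>UNIV. t j ^ (\<delta> $ j)))
         = (if \<alpha> = \<delta> then of_nat (card T) else 0)"
  shows "(\<Sum>t\<in>T. degform x n (comp_op u (comp_op (\<chi> i k. if i = k then t i else 0) f)))
    = card T * degform (\<lambda>\<alpha>. degform x n (comp_op u (zmonom \<alpha>))) n f"
proof -
  let ?I = "{\<alpha> :: nat ^ 'd. mlen \<alpha> = n}" and ?t = "\<lambda>t \<alpha>. \<Prod>j\<in>UNIV. t j ^ (\<alpha> $ j)"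
  have par: "(\<Sum>t\<in>T. (cmod (\<Sum>\<alpha>\<in>?I. ?t t \<alpha> * c \<alpha>))\<^sup>2) = card T * (\<Sum>\<alpha>\<in>?I. (cmod (c \<alpha>))\<^sup>2)" for c
  proof -
    have "complex_of_real (\<Sum>t\<in>T. (cmod (\<Sum>\<alpha>\<in>?I. ?t t \<alpha> * c \<alpha>))\<^sup>2)
        = (\<Sum>t\<in>T. \<Sum>\<alpha>\<in>?I. \<Sum>\<delta>\<in>?I. (?t t \<alpha> * cnj (?t t \<delta>)) * (c \<alpha> * cnj (c \<delta>)))"
      by (simp add: of_real_cmod_square sum_product mult_ac del: cnj_prod)
    also have "\<dots> = (\<Sum>\<alpha>\<in>?I. \<Sum>\<delta>\<in>?I. \<Sum>t\<in>T. (?t t \<alpha> * cnj (?t t \<delta>)) * (c \<alpha> * cnj (c \<delta>)))"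
      by (subst sum.swap, rule sum.cong[OF refl], rule sum.swap)
    also have "\<dots> = (\<Sum>\<alpha>\<in>?I. \<Sum>\<delta>\<in>?I. if \<alpha> = \<delta> then card T * (c \<alpha> * cnj (c \<delta>)) else 0)"
      unfolding sum_distrib_right[symmetric] by (intro sum.cong) (auto simp: T(2) simp del: cnj_prod)
    also have "\<dots> = complex_of_real (card T * (\<Sum>\<alpha>\<in>?I. (cmod (c \<alpha>))\<^sup>2))"
      by (simp add: finite_mlen_eq of_real_cmod_square sum_distrib_left)
    finally show ?thesis by (simp only: of_real_eq_iff)
  qed
  have "(\<Sum>t\<in>T. degform x n (comp_op u (comp_op (\<chi> i k. if i = k then t i else 0) f)))
     = (\<Sum>\<gamma>\<in>?I. x \<gamma> * (\<Sum>t\<in>T. (cmod (\<Sum>\<alpha>\<in>?I. ?t t \<alpha> * (f \<alpha> * comp_op u (zmonom \<alpha>) \<gamma>)))\<^sup>2))"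
    unfolding degform_def sum_distrib_left
    by (subst sum.swap, intro sum.cong refl, subst comp_op_zmonom_expand)
       (auto simp: comp_op_diag mult.assoc)
  also have "\<dots> = (\<Sum>\<gamma>\<in>?I. x \<gamma> * (card T * (\<Sum>\<alpha>\<in>?I. (cmod (f \<alpha> * comp_op u (zmonom \<alpha>) \<gamma>))\<^sup>2)))"
    unfolding par ..
  also have "\<dots> = card T * degform (\<lambda>\<alpha>. degform x n (comp_op u (zmonom \<alpha>))) n f"
    unfolding degform_def sum_distrib_left sum_distrib_right
    by (subst sum.swap) (simp add: norm_mult power_mult_distrib mult_ac)
  finally show ?thesis .
qed

section \<open>Weights with uniformly bounded substitutions\<close>

text \<open>
  Doeblin's argument: two rows of a stochastic matrix with a column bounded below by \<open>\<epsilon>\<close> share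
  the mass \<open>\<epsilon>\<close> there, so only the remaining mass \<open>1 - \<epsilon>\<close> can contribute to a difference of
  weighted means.
\<close>

lemma doeblin_contraction:
  fixes p :: "'i \<Rightarrow> 'i \<Rightarrow> real"
  assumes fin: "finite I" and p: "\<And>a g. a \<in> I \<Longrightarrow> g \<in> I \<Longrightarrow> p a g \<ge> 0"
    and row: "\<And>a. a \<in> I \<Longrightarrow> (\<Sum>g\<in>I. p a g) = 1"
    and c: "c \<in> I" "\<And>a. a \<in> I \<Longrightarrow> p a c \<ge> \<epsilon>"
    and osc: "\<And>a b. a \<in> I \<Longrightarrow> b \<in> I \<Longrightarrow> y a - y b \<le> D"
    and ab: "a \<in> I" "b \<in> I"
  shows "(\<Sum>g\<in>I. p a g * y g) - (\<Sum>g\<in>I. p b g * y g) \<le> (1 - \<epsilon>) * D"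
proof -
  \<comment> \<open>The common mass \<open>\<epsilon>\<close> at \<open>c\<close> is removed from each row.\<close>
  define q where "q a g = p a g - (if g = c then \<epsilon> else 0)" for a g
  have q: "q a g \<ge> 0" if "a \<in> I" "g \<in> I" for a g
    using p[OF that] c(2)[OF that(1)] by (simp add: q_def)
  have qs: "(\<Sum>g\<in>I. q a g) = 1 - \<epsilon>" if "a \<in> I" for a
    using row[OF that] fin c(1) by (simp add: q_def sum_subtractf)
  have split: "(\<Sum>g\<in>I. p a g * y g) = (\<Sum>g\<in>I. q a g * y g) + \<epsilon> * y c" for a
  proof -
    have "(\<Sum>g\<in>I. p a g * y g) = (\<Sum>g\<in>I. q a g * y g + (if g = c then \<epsilon> * y c else 0))"
      by (intro sum.cong) (auto simp: q_def algebra_simps)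
    then show ?thesis using fin c(1) by (simp add: sum.distrib)
  qed
  have "Min (y ` I) \<in> y ` I" using fin c(1) by (intro Min_in) auto
  then obtain m where m: "m \<in> I" "y m = Min (y ` I)" by auto
  have le: "y m \<le> y g" if "g \<in> I" for g using fin that m(2) by simp
  have "(\<Sum>g\<in>I. q a g * y g) \<le> (\<Sum>g\<in>I. q a g * (y m + D))"
    using osc[OF _ m(1)] q[OF ab(1)] by (intro sum_mono mult_left_mono) (auto simp: algebra_simps)
  moreover have "(\<Sum>g\<in>I. q b g * y m) \<le> (\<Sum>g\<in>I. q b g * y g)"
    using le q[OF ab(2)] by (intro sum_mono mult_left_mono) auto
  ultimately show ?thesis
    unfolding split sum_distrib_right[symmetric] qs[OF ab(1)] qs[OF ab(2)] by (simp add: algebra_simps)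
qed

text \<open>
  The set \<open>Q\<close> of weights squeezed by the given one along all orbits of the unitary group is
  invariant under \<open>step\<close>: after averaging, \<open>C\<^sub>u\<close> is merely replaced by the operators \<open>C\<^bsub>utv\<^esub>\<close>. In
  the coordinates \<open>x\<^sub>\<alpha> / \<alpha>!\<close> the map \<open>step\<close> is a stochastic matrix, by Fock invariance, and
  its iterates contract. Since every iterate is squeezed by the same factors, letting the
  oscillation vanish compares the original weight with a constant. The bound does not depend
  on the degree.
\<close>

theorem weights_comparable:
  fixes w :: "nat ^ 'd::finite \<Rightarrow> real"
  assumes w: "\<And>\<alpha>. w \<alpha> > 0" and K: "K > 0"
    and bound: "\<And>u f. u \<in> unitary_group \<Longrightarrow> degform w n (comp_op u f) \<le> K * degform w n f"
    and len: "mlen \<alpha> = n" "mlen \<delta> = n"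
  shows "w \<alpha> / mfact \<alpha> \<le> K\<^sup>2 * (w \<delta> / mfact \<delta>)"
proof -
  define I where "I = {\<alpha> :: nat ^ 'd. mlen \<alpha> = n}"
  have finI: "finite I" by (simp add: I_def finite_mlen_eq)
  define Q where "Q x \<longleftrightarrow> (\<forall>u \<in> unitary_group. \<forall>f. degform w n f \<le> K * degform x n (comp_op u f) \<and>
      degform x n (comp_op u f) \<le> K * degform w n f)" for x
  have Qw: "Q w"
    unfolding Q_def
  proof (intro ballI allI conjI)
    fix u :: "complex ^ 'd ^ 'd" and f assume u: "u \<in> unitary_group"
    show "degform w n (comp_op u f) \<le> K * degform w n f" by (rule bound[OF u])
    show "degform w n f \<le> K * degform w n (comp_op u f)"
      using bound[OF unitary_adj[OF u], of "comp_op u f"] by (simp add: comp_op_adj[OF u])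
  qed
  obtain v :: "complex ^ 'd ^ 'd" where v: "v \<in> unitary_group" "\<And>i j. v $ i $ j \<noteq> 0"
    using unitary_full_exists by blast
  define step where "step x = (\<lambda>\<alpha>. degform x n (comp_op v (zmonom \<alpha>)))" for x
  have Qstep: "Q (step x)" if Q: "Q x" for x
    unfolding Q_def
  proof (intro ballI allI)
    fix u :: "complex ^ 'd ^ 'd" and f assume u: "u \<in> unitary_group"
    obtain T :: "('d \<Rightarrow> complex) set" where T: "finite T" "T \<noteq> {}"
      "\<And>t i. t \<in> T \<Longrightarrow> cmod (t i) = 1"
      "\<And>\<alpha> \<delta> :: nat ^ 'd. mlen \<alpha> = n \<Longrightarrow> mlen \<delta> = n \<Longrightarrow>
       (\<Sum>t\<in>T. (\<Prod>j\<in>UNIV. t j ^ (\<alpha> $ j)) * cnj (\<Prod>j\<in>UNIV. t j ^ (\<delta> $ j)))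
         = (if \<alpha> = \<delta> then of_nat (card T) else 0)"
      by (rule torus_orthogonality[of n]) (rule that; assumption)
    let ?d = "\<lambda>t :: 'd \<Rightarrow> complex. \<chi> i k. if i = k then t i else 0"
    have pos: "real (card T) > 0" using T(1,2) by (simp add: card_gt_0_iff)
    have avg: "card T * degform (step x) n (comp_op u f)
        = (\<Sum>t\<in>T. degform x n (comp_op (u ** ?d t ** v) f))"
      using torus_average[OF T(1,4), where x = x and u = v and f = "comp_op u f"]
      by (simp add: step_def comp_op_comp[abs_def] matrix_mul_assoc)
    have mem: "u ** ?d t ** v \<in> unitary_group" if "t \<in> T" for t
      using that T(3) by (intro unitary_mult u v unitary_diag) auto
    have "(\<Sum>t\<in>T. degform w n f) \<le> (\<Sum>t\<in>T. K * degform x n (comp_op (u ** ?d t ** v) f))"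
      using mem Q by (intro sum_mono) (auto simp: Q_def)
    then have "card T * degform w n f \<le> card T * (K * degform (step x) n (comp_op u f))"
      by (simp add: sum_distrib_left[symmetric] avg[symmetric] mult.left_commute)
    moreover have "(\<Sum>t\<in>T. degform x n (comp_op (u ** ?d t ** v) f)) \<le> (\<Sum>t\<in>T. K * degform w n f)"
      using mem Q by (intro sum_mono) (auto simp: Q_def)
    then have "card T * degform (step x) n (comp_op u f) \<le> card T * (K * degform w n f)"
      by (simp add: avg)
    ultimately show "degform w n f \<le> K * degform (step x) n (comp_op u f) \<and>
        degform (step x) n (comp_op u f) \<le> K * degform w n f"
      using pos by simp
  qed
  \<comment> \<open>The squared moduli of the entries of a matrix unitary for the Fock norm.\<close>
  define p where "p \<alpha> \<gamma> = mfact \<gamma> * (cmod (comp_op v (zmonom \<alpha>) \<gamma>))\<^sup>2 / mfact \<alpha>" for \<alpha> \<gamma> :: "nat ^ 'd"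
  have p0: "p \<alpha> \<gamma> \<ge> 0" for \<alpha> \<gamma>
    using mfact_pos[of \<alpha>] mfact_pos[of \<gamma>] by (simp add: p_def)
  have row: "(\<Sum>\<gamma>\<in>I. p \<alpha> \<gamma>) = 1" if "\<alpha> \<in> I" for \<alpha>
  proof -
    have "(\<Sum>\<gamma>\<in>I. p \<alpha> \<gamma>) = degform mfact n (comp_op v (zmonom \<alpha>)) / mfact \<alpha>"
      by (simp add: p_def degform_def I_def sum_divide_distrib)
    also have "\<dots> = 1"
      using that mfact_pos[of \<alpha>] by (simp add: degform_mfact_comp_op[OF v(1)] degform_zmonom I_def)
    finally show ?thesis .
  qed
  have step_eq: "step x \<alpha> / mfact \<alpha> = (\<Sum>\<gamma>\<in>I. p \<alpha> \<gamma> * (x \<gamma> / mfact \<gamma>))" for x \<alpha>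
  proof -
    have "mfact \<gamma> \<noteq> 0" for \<gamma> :: "nat ^ 'd" using mfact_pos[of \<gamma>] by simp
    then show ?thesis
      by (simp add: step_def degform_def I_def p_def sum_divide_distrib mult.commute)
  qed
  \<comment> \<open>The column of \<open>z\<^sub>j\<^sup>n\<close> for an arbitrary index \<open>j\<close> is strictly positive.\<close>
  define c :: "nat ^ 'd" where "c = axis undefined n"
  have c: "c \<in> I" by (simp add: c_def I_def mlen_def axis_def)
  have pc: "p \<alpha> c > 0" if "\<alpha> \<in> I" for \<alpha>
    using comp_op_zmonom_axis_nonzero[of v undefined \<alpha> n] v(2) that mfact_pos[of \<alpha>] mfact_pos[of c]
    by (simp add: p_def c_def I_def)
  define \<epsilon> where "\<epsilon> = Min ((\<lambda>\<alpha>. p \<alpha> c) ` I)"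
  have \<epsilon>_le: "\<epsilon> \<le> p \<alpha> c" if "\<alpha> \<in> I" for \<alpha>
    using that finI by (simp add: \<epsilon>_def)
  have \<epsilon>_pos: "\<epsilon> > 0"
    using pc finI c by (subst \<epsilon>_def, subst Min_gr_iff) auto
  have "\<epsilon> \<le> p c c" by (rule \<epsilon>_le[OF c])
  also have "\<dots> \<le> (\<Sum>\<gamma>\<in>I. p c \<gamma>)"
    using finI c p0 by (intro member_le_sum) auto
  also have "\<dots> = 1" by (rule row[OF c])
  finally have \<epsilon>_1: "\<epsilon> \<le> 1" .
  define D where "D = (\<Sum>\<alpha>\<in>I. w \<alpha> / mfact \<alpha>)"
  have iter: "\<exists>x. Q x \<and> (\<forall>a\<in>I. \<forall>b\<in>I. x a / mfact a - x b / mfact b \<le> (1 - \<epsilon>) ^ m * D)" for m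
  proof (induction m)
    case 0
    \<comment> \<open>The value of \<open>D\<close> is a crude bound for the initial oscillation.\<close>
    have "w a / mfact a - w b / mfact b \<le> D" if "a \<in> I" "b \<in> I" for a b
    proof -
      have pos: "w a / mfact a > 0" for a by (intro divide_pos_pos w mfact_pos)
      have "w a / mfact a \<le> D"
        unfolding D_def using that finI pos by (intro member_le_sum) (auto simp: less_imp_le)
      then show ?thesis using pos[of b] by linarith
    qed
    then show ?case using Qw by auto
  next
    case (Suc m)
    then obtain x where x: "Q x" "\<And>a b. a \<in> I \<Longrightarrow> b \<in> I \<Longrightarrow> x a / mfact a - x b / mfact b \<le> (1 - \<epsilon>) ^ m * D"
      by auto
    have "step x a / mfact a - step x b / mfact b \<le> (1 - \<epsilon>) * ((1 - \<epsilon>) ^ m * D)" if "a \<in> I" "b \<in> I" for a b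
      unfolding step_eq
      by (rule doeblin_contraction[OF finI p0 row c \<epsilon>_le x(2) that])
    then show ?case using Qstep[OF x(1)] by (auto simp: mult.assoc)
  qed
  have I: "\<alpha> \<in> I" "\<delta> \<in> I" using len by (simp_all add: I_def)
  have "w \<alpha> / mfact \<alpha> \<le> K\<^sup>2 * (w \<delta> / mfact \<delta>) + K * ((1 - \<epsilon>) ^ m * D)" for m
  proof -
    obtain x where x: "Q x" "x \<alpha> / mfact \<alpha> - x \<delta> / mfact \<delta> \<le> (1 - \<epsilon>) ^ m * D"
      using iter[of m] I by blast
    have Q1: "degform w n f \<le> K * degform x n f" "degform x n f \<le> K * degform w n f" for f
      using x(1) unitary_one unfolding Q_def by (metis comp_op_mat_1)+
    have 1: "w \<alpha> \<le> K * x \<alpha>" using Q1(1)[of "zmonom \<alpha>"] len by (simp add: degform_zmonom)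
    have 2: "x \<delta> \<le> K * w \<delta>" using Q1(2)[of "zmonom \<delta>"] len by (simp add: degform_zmonom)
    have "w \<alpha> / mfact \<alpha> \<le> K * (x \<alpha> / mfact \<alpha>)"
      using divide_right_mono[OF 1, of "mfact \<alpha>"] mfact_pos[of \<alpha>] by simp
    also have "\<dots> \<le> K * (x \<delta> / mfact \<delta> + (1 - \<epsilon>) ^ m * D)"
      using x(2) K by (intro mult_left_mono) auto
    also have "\<dots> \<le> K * (K * (w \<delta> / mfact \<delta>) + (1 - \<epsilon>) ^ m * D)"
      using divide_right_mono[OF 2, of "mfact \<delta>"] mfact_pos[of \<delta>] K
      by (intro mult_left_mono add_right_mono) auto
    finally show ?thesis by (simp add: algebra_simps power2_eq_square)
  qed
  moreover have "(\<lambda>m. K\<^sup>2 * (w \<delta> / mfact \<delta>) + K * ((1 - \<epsilon>) ^ m * D)) \<longlonglongrightarrow> K\<^sup>2 * (w \<delta> / mfact \<delta>) + K * (0 * D)"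
    using \<epsilon>_pos \<epsilon>_1 by (intro tendsto_intros LIMSEQ_power_zero) auto
  ultimately show ?thesis
    using LIMSEQ_le_const by fastforce
qed

section \<open>Degreewise description of the weighted spaces\<close>

lemma finite_mlen_less: "finite {\<alpha> :: nat ^ 'd::finite. mlen \<alpha> < N}"
proof -
  have "{\<alpha> :: nat ^ 'd. mlen \<alpha> < N} = (\<Union>n<N. {\<alpha>. mlen \<alpha> = n})" by auto
  then show ?thesis by (simp add: finite_mlen_eq)
qed

lemma sum_by_degree:
  "(\<Sum>n<N. \<Sum>\<alpha> | mlen \<alpha> = n. F \<alpha>) = (\<Sum>\<alpha> | mlen (\<alpha> :: nat ^ 'd::finite) < N. F \<alpha>)"
proof -
  have "(\<Sum>n<N. \<Sum>\<alpha> | mlen \<alpha> = n. F \<alpha>)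
      = (\<Sum>n<N. sum F {\<alpha> \<in> {\<alpha>. mlen \<alpha> < N}. mlen \<alpha> = n})"
    by (intro sum.cong) auto
  also have "\<dots> = sum F {\<alpha>. mlen \<alpha> < N}"
    by (rule sum.group) (auto simp: finite_mlen_less)
  finally show ?thesis .
qed

lemma finite_subset_mlen_less:
  assumes "finite (F :: (nat ^ 'd::finite) set)"
  shows "\<exists>N. F \<subseteq> {\<alpha>. mlen \<alpha> < N}"
proof
  show "F \<subseteq> {\<alpha>. mlen \<alpha> < Suc (Max (mlen ` F))}"
    using assms by (auto simp: less_Suc_eq_le)
qed

text \<open>
  The weight for \<open>degform\<close> that belongs to \<open>H\<^sup>2(\<beta>)\<close>, as \<open>\<beta>\<^sub>\<alpha>\<close> is the norm of \<open>z\<^sup>\<alpha>\<close>.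
\<close>

abbreviation square_weight :: "(nat ^ 'd::finite \<Rightarrow> real) \<Rightarrow> nat ^ 'd \<Rightarrow> real"
  where "square_weight \<beta> \<equiv> (\<lambda>\<alpha>. (\<beta> \<alpha>)\<^sup>2)"

lemma in_H2_iff: "f \<in> hcarrier (H2 \<beta>) \<longleftrightarrow> (\<lambda>\<alpha>. (cmod (f \<alpha>))\<^sup>2 * (\<beta> \<alpha>)\<^sup>2) summable_on UNIV"
  by (simp add: H2_def)

text \<open>
  Membership and norm bounds are expressed through finite sums over degrees, so that estimates
  valid in each degree pass to the whole space; \<open>degreewise_bound\<close> does this.
\<close>

lemma H2_norm_le_iff:
  "f \<in> hcarrier (H2 \<beta>) \<and> (hnorm (H2 \<beta>) f)\<^sup>2 \<le> M \<longleftrightarrow> (\<forall>N. (\<Sum>n<N. degform (square_weight \<beta>) n f) \<le> M)"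
proof
  let ?g = "\<lambda>\<alpha>. (cmod (f \<alpha>))\<^sup>2 * (\<beta> \<alpha>)\<^sup>2"
  have part: "(\<Sum>n<N. degform (square_weight \<beta>) n f) = sum ?g {\<alpha>. mlen \<alpha> < N}" for N
    unfolding degform_def sum_by_degree[symmetric] by (simp add: mult.commute)
  have sq: "(hnorm (H2 \<beta>) f)\<^sup>2 = infsum ?g UNIV" if "f \<in> hcarrier (H2 \<beta>)"
    by (simp add: hnorm_H2[OF that] infsum_nonneg)
  {
    assume *: "f \<in> hcarrier (H2 \<beta>) \<and> (hnorm (H2 \<beta>) f)\<^sup>2 \<le> M"
    show "\<forall>N. (\<Sum>n<N. degform (square_weight \<beta>) n f) \<le> M"
    proof
      fix N
      have "sum ?g {\<alpha>. mlen \<alpha> < N} \<le> infsum ?g UNIV"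
        using * by (intro finite_sum_le_infsum) (auto simp: in_H2_iff finite_mlen_less)
      then show "(\<Sum>n<N. degform (square_weight \<beta>) n f) \<le> M" using * sq part by simp
    qed
  next
    assume *: "\<forall>N. (\<Sum>n<N. degform (square_weight \<beta>) n f) \<le> M"
    have le: "sum ?g F \<le> M" if F: "finite F" for F
    proof -
      obtain N where "F \<subseteq> {\<alpha>. mlen \<alpha> < N}" using finite_subset_mlen_less[OF F] ..
      then have "sum ?g F \<le> sum ?g {\<alpha>. mlen \<alpha> < N}"
        by (intro sum_mono2) (auto simp: finite_mlen_less)
      then show ?thesis using spec[OF *, of N] part[of N] by linarith
    qed
    then have "?g summable_on UNIV"
      by (intro nonneg_bdd_above_summable_on) (auto intro!: bdd_aboveI[of _ M])
    moreover from this have "infsum ?g UNIV \<le> M"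
      by (rule infsum_le_finite_sums) (rule le)
    ultimately show "f \<in> hcarrier (H2 \<beta>) \<and> (hnorm (H2 \<beta>) f)\<^sup>2 \<le> M"
      using sq by (simp add: in_H2_iff)
  }
qed

lemma hnorm_nonneg: "f \<in> hcarrier (H2 \<beta>) \<Longrightarrow> hnorm (H2 \<beta>) f \<ge> 0"
  by (simp add: hnorm_H2 infsum_nonneg)

lemma degreewise_bound:
  assumes f: "f \<in> hcarrier (H2 \<beta>)" and C: "C \<ge> 0"
    and le: "\<And>n. degform (square_weight \<beta>') n g \<le> C * degform (square_weight \<beta>) n f"
  shows "g \<in> hcarrier (H2 \<beta>')" "hnorm (H2 \<beta>') g \<le> sqrt C * hnorm (H2 \<beta>) f"
proof -
  have f': "(\<Sum>n<N. degform (square_weight \<beta>) n f) \<le> (hnorm (H2 \<beta>) f)\<^sup>2" for N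
    using H2_norm_le_iff[of f \<beta>] f by blast
  have "(\<Sum>n<N. degform (square_weight \<beta>') n g) \<le> C * (hnorm (H2 \<beta>) f)\<^sup>2" for N
  proof -
    have "(\<Sum>n<N. degform (square_weight \<beta>') n g) \<le> C * (\<Sum>n<N. degform (square_weight \<beta>) n f)"
      unfolding sum_distrib_left by (intro sum_mono le)
    also have "\<dots> \<le> C * (hnorm (H2 \<beta>) f)\<^sup>2" using f' C by (intro mult_left_mono)
    finally show ?thesis .
  qed
  then have *: "g \<in> hcarrier (H2 \<beta>')" "(hnorm (H2 \<beta>') g)\<^sup>2 \<le> C * (hnorm (H2 \<beta>) f)\<^sup>2"
    using H2_norm_le_iff[of g \<beta>'] by blast+
  show "g \<in> hcarrier (H2 \<beta>')" by fact
  have "sqrt ((hnorm (H2 \<beta>') g)\<^sup>2) \<le> sqrt (C * (hnorm (H2 \<beta>) f)\<^sup>2)"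
    by (rule real_sqrt_le_mono[OF *(2)])
  then show "hnorm (H2 \<beta>') g \<le> sqrt C * hnorm (H2 \<beta>) f"
    using hnorm_nonneg[OF f] hnorm_nonneg[OF *(1)] by (simp add: real_sqrt_mult)
qed

lemma H2_add:
  assumes "f \<in> hcarrier (H2 \<beta>)" "g \<in> hcarrier (H2 \<beta>)"
  shows "(\<lambda>\<alpha>. f \<alpha> + g \<alpha>) \<in> hcarrier (H2 \<beta>)"
proof -
  have "(\<lambda>\<alpha>. 2 * ((cmod (f \<alpha>))\<^sup>2 * (\<beta> \<alpha>)\<^sup>2) + 2 * ((cmod (g \<alpha>))\<^sup>2 * (\<beta> \<alpha>)\<^sup>2)) summable_on UNIV"
    using assms unfolding in_H2_iff by (intro summable_on_add summable_on_cmult_right)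
  then show ?thesis unfolding in_H2_iff
  proof (rule summable_on_comparison_test)
    fix \<alpha>
    have "(cmod (f \<alpha> + g \<alpha>))\<^sup>2 \<le> (cmod (f \<alpha>) + cmod (g \<alpha>))\<^sup>2"
      by (intro power_mono norm_triangle_ineq) simp
    also have "\<dots> \<le> 2 * (cmod (f \<alpha>))\<^sup>2 + 2 * (cmod (g \<alpha>))\<^sup>2"
      using sum_squares_bound[of "cmod (f \<alpha>)" "cmod (g \<alpha>)"] by (simp add: power2_sum)
    finally have "(cmod (f \<alpha> + g \<alpha>))\<^sup>2 * (\<beta> \<alpha>)\<^sup>2 \<le> (2 * (cmod (f \<alpha>))\<^sup>2 + 2 * (cmod (g \<alpha>))\<^sup>2) * (\<beta> \<alpha>)\<^sup>2"
      by (intro mult_right_mono) auto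
    then show "(cmod (f \<alpha> + g \<alpha>))\<^sup>2 * (\<beta> \<alpha>)\<^sup>2
       \<le> 2 * ((cmod (f \<alpha>))\<^sup>2 * (\<beta> \<alpha>)\<^sup>2) + 2 * ((cmod (g \<alpha>))\<^sup>2 * (\<beta> \<alpha>)\<^sup>2)"
      by (simp add: algebra_simps)
  qed simp
qed

lemma H2_scale: "f \<in> hcarrier (H2 \<beta>) \<Longrightarrow> (\<lambda>\<alpha>. c * f \<alpha>) \<in> hcarrier (H2 \<beta>)"
  using summable_on_cmult_right[of "\<lambda>\<alpha>. (cmod (f \<alpha>))\<^sup>2 * (\<beta> \<alpha>)\<^sup>2" UNIV "(cmod c)\<^sup>2"]
  by (simp add: in_H2_iff norm_mult power_mult_distrib mult.assoc)

lemma H2_finite_support: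
  assumes "finite {\<alpha>. f \<alpha> \<noteq> 0}"
  shows "f \<in> hcarrier (H2 \<beta>)"
  unfolding in_H2_iff
  using assms by (subst summable_on_cong_neutral[where T = "{\<alpha>. f \<alpha> \<noteq> 0}"]) auto

lemma H2_sum:
  assumes "finite A" "\<And>i. i \<in> A \<Longrightarrow> f i \<in> hcarrier (H2 \<beta>)"
  shows "(\<lambda>\<alpha>. \<Sum>i\<in>A. f i \<alpha>) \<in> hcarrier (H2 \<beta>)"
  using assms by (induction A rule: finite_induct) (auto simp: H2_add H2_finite_support)

lemma linear_opD:
  assumes "linear_op H K T"
  shows "\<And>f. f \<in> hcarrier H \<Longrightarrow> T f \<in> hcarrier K"
    and "\<And>f g. f \<in> hcarrier H \<Longrightarrow> g \<in> hcarrier H \<Longrightarrow> T (\<lambda>i. f i + g i) = (\<lambda>k. T f k + T g k)"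
    and "\<And>f c. f \<in> hcarrier H \<Longrightarrow> T (\<lambda>i. c * f i) = (\<lambda>k. c * T f k)"
  using assms unfolding linear_op_def by blast+

lemma linear_op_sum:
  assumes T: "linear_op (H2 \<beta>) (H2 \<beta>') T" and "finite A" "\<And>i. i \<in> A \<Longrightarrow> f i \<in> hcarrier (H2 \<beta>)"
  shows "T (\<lambda>\<alpha>. \<Sum>i\<in>A. f i \<alpha>) = (\<lambda>\<alpha>. \<Sum>i\<in>A. T (f i) \<alpha>)"
  using assms(2,3)
proof (induction A rule: finite_induct)
  case empty
  have z: "(\<lambda>_. 0) \<in> hcarrier (H2 \<beta>)" by (rule H2_finite_support) simp
  show ?case using linear_opD(3)[OF T z, of 0] by simp
next
  case (insert a A)
  have "T (\<lambda>\<alpha>. f a \<alpha> + (\<Sum>i\<in>A. f i \<alpha>)) = (\<lambda>\<alpha>. T (f a) \<alpha> + T (\<lambda>\<alpha>. \<Sum>i\<in>A. f i \<alpha>) \<alpha>)"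
    using insert.prems insert.hyps(1) by (intro linear_opD(2)[OF T] H2_sum) auto
  then show ?case using insert by simp
qed

section \<open>Uniform boundedness over the unitary group\<close>

lemma compact_unitary_group: "compact (unitary_group :: (complex ^ 'd ^ 'd::finite) set)"
  unfolding compact_eq_bounded_closed
proof
  have "cmod (u $ i $ j) \<le> 1" if "u \<in> unitary_group" for u :: "complex ^ 'd ^ 'd" and i j
  proof -
    have "complex_of_real (\<Sum>k\<in>UNIV. (cmod (u $ i $ k))\<^sup>2) = 1"
      using unitary_rows[OF that, of i i] by (simp add: of_real_cmod_square)
    then have "(\<Sum>k\<in>UNIV. (cmod (u $ i $ k))\<^sup>2) = 1" by (simp only: of_real_eq_1_iff)
    then have "(cmod (u $ i $ j))\<^sup>2 \<le> 1"
      using member_le_sum[of j UNIV "\<lambda>k. (cmod (u $ i $ k))\<^sup>2"] by simp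
    then show ?thesis by (simp add: abs_square_le_1)
  qed
  moreover have l1: "norm x \<le> (\<Sum>i\<in>UNIV. norm (x $ i))" for x :: "'b::real_normed_vector ^ 'd"
    unfolding norm_vec_def by (rule L2_set_le_sum) simp
  ultimately have "norm u \<le> (\<Sum>i\<in>(UNIV :: 'd set). \<Sum>j\<in>(UNIV :: 'd set). 1)" if "u \<in> unitary_group" for u :: "complex ^ 'd ^ 'd"
    using that by (intro order_trans[OF l1] sum_mono) simp
  then show "bounded (unitary_group :: (complex ^ 'd ^ 'd) set)"
    by (auto simp: bounded_iff)
  have "closed {u :: complex ^ 'd ^ 'd. \<forall>i j. (u ** mat_adjoint u) $ i $ j = mat 1 $ i $ j \<and> (mat_adjoint u ** u) $ i $ j = mat 1 $ i $ j}"
    unfolding matrix_matrix_mult_def mat_adjoint_def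
    by (intro closed_Collect_all closed_Collect_conj closed_Collect_eq) (auto intro!: continuous_intros)
  then show "closed (unitary_group :: (complex ^ 'd ^ 'd) set)"
    by (rule back_subst[of closed]) (auto simp: unitary_iff vec_eq_iff)
qed

lemma continuous_comp_op: "continuous_on UNIV (\<lambda>u :: complex ^ 'd ^ 'd::finite. comp_op u f \<gamma>)"
proof (induction "mlen \<gamma>" arbitrary: f \<gamma>)
  case 0
  then show ?case by (simp add: mlen_eq_0 comp_op_at_0)
next
  case (Suc n)
  have "continuous_on UNIV (\<lambda>u :: complex ^ 'd ^ 'd. Mz k (comp_op u h) \<gamma>)" for k h
  proof (cases "\<gamma> $ k = 0")
    case False
    then have "n = mlen (\<gamma> - axis k 1)" using mlen_minus_axis[of \<gamma> k n] Suc(2) by simp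
    from Suc(1)[OF this] show ?thesis using False by (simp add: Mz_def)
  qed (simp add: Mz_def)
  then show ?case
    by (subst comp_op_euler) (intro continuous_intros)
qed

text \<open>
  A uniform boundedness principle for the group. The sets \<open>F N\<close> of matrices with bound \<open>N\<close> are
  closed and cover the unitary group, so by Baire's theorem one of them contains a neighbourhood
  of some \<open>x\<close>. Every \<open>v\<close> can be moved to \<open>x\<close> by a fixed left translation at the
  cost of a constant factor; the group is covered by finitely many such neighbourhoods.
\<close>

lemma uniform_degree_bound:
  fixes w :: "nat ^ 'd::finite \<Rightarrow> real"
  assumes w: "\<And>\<alpha>. w \<alpha> \<ge> 0"
    and bound: "\<And>u. u \<in> unitary_group \<Longrightarrow> \<exists>C. \<forall>n f. degform w n (comp_op u f) \<le> C * degform w n f"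
  shows "\<exists>K>0. \<forall>u\<in>unitary_group. \<forall>n f. degform w n (comp_op u f) \<le> K * degform w n f"
proof -
  let ?U = "unitary_group :: (complex ^ 'd ^ 'd) set"
  let ?B = "\<lambda>K u. \<forall>n f. degform w n (comp_op u f) \<le> K * degform w n f"
  have mono: "?B K' u" if "?B K u" "K \<le> K'" for K K' u
    using that degform_nonneg[of w] w by (meson mult_right_mono order_trans)
  have closedU: "closed ?U" using compact_unitary_group by (rule compact_imp_closed)
  define F where "F N = {u. ?B (real N) u}" for N
  have closedF: "closed (F N)" for N
    unfolding F_def degform_def
    by (intro closed_Collect_all closed_Collect_le continuous_intros continuous_comp_op)
  have cover: "\<exists>N. u \<in> F N" if u: "u \<in> ?U" for u
  proof -
    obtain C where "?B C u" using bound[OF u] by blast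
    moreover obtain N where "C \<le> real N" using real_arch_simple by blast
    ultimately show ?thesis using mono unfolding F_def by blast
  qed
  have "\<exists>N. \<not> ?U \<subseteq> closure (?U - F N)"
  proof (rule ccontr)
    assume "\<not> ?thesis"
    then have "?U \<subseteq> closure (\<Inter>(range (\<lambda>N. ?U - F N)))"
      using closedF by (intro Baire closedU) (auto simp: openin_open Diff_eq intro!: exI[of _ "- F _"])
    moreover have "\<Inter>(range (\<lambda>N. ?U - F N)) = {}" using cover by auto
    ultimately have "?U \<subseteq> closure {}" by (simp only:)
    then show False using unitary_one by auto
  qed
  then obtain N x where x: "x \<in> ?U" "x \<notin> closure (?U - F N)" by blast
  then obtain e where e: "e > 0" "\<And>y. y \<in> ?U \<Longrightarrow> dist y x < e \<Longrightarrow> y \<in> F N"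
    unfolding closure_approachable by blast
  have "\<exists>V C. open V \<and> v \<in> V \<and> C \<ge> 0 \<and> (\<forall>y \<in> V \<inter> ?U. ?B C y)" if v: "v \<in> ?U" for v
  proof -
    define \<phi> where "\<phi> y = x ** mat_adjoint v ** y" for y :: "complex ^ 'd ^ 'd"
    have cont: "continuous_on UNIV \<phi>"
      unfolding \<phi>_def matrix_matrix_mult_def by (intro continuous_intros)
    have "\<phi> v = x"
      using v by (simp add: \<phi>_def matrix_mul_assoc[symmetric] unitary_iff)
    obtain C where C: "?B C (v ** mat_adjoint x)"
      using bound[OF unitary_mult[OF v unitary_adj[OF x(1)]]] by blast
    have C': "?B \<bar>C\<bar> (v ** mat_adjoint x)" by (rule mono[OF C]) simp
    have "?B (real N * \<bar>C\<bar>) y" if y: "y \<in> \<phi> -` ball x e" "y \<in> ?U" for y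
    proof (intro allI)
      fix n f
      have "\<phi> y \<in> ?U" unfolding \<phi>_def by (intro unitary_mult unitary_adj x v y)
      then have FN: "\<phi> y \<in> F N" using e(2) y(1) by (simp add: dist_commute)
      have "v ** mat_adjoint x ** \<phi> y = v ** (mat_adjoint x ** x) ** mat_adjoint v ** y"
        by (simp add: \<phi>_def matrix_mul_assoc)
      also have "\<dots> = y" using x(1) v by (simp add: unitary_iff)
      finally have "comp_op y f = comp_op (\<phi> y) (comp_op (v ** mat_adjoint x) f)"
        by (simp add: comp_op_comp fun_eq_iff)
      then have "degform w n (comp_op y f) \<le> real N * degform w n (comp_op (v ** mat_adjoint x) f)"
        using FN by (simp add: F_def)
      also have "\<dots> \<le> real N * (\<bar>C\<bar> * degform w n f)"
        using C' by (intro mult_left_mono) auto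
      finally show "degform w n (comp_op y f) \<le> (real N * \<bar>C\<bar>) * degform w n f"
        by (simp add: mult.assoc)
    qed
    moreover have "open (\<phi> -` ball x e)" using cont by (simp add: open_vimage)
    moreover have "v \<in> \<phi> -` ball x e" using \<open>\<phi> v = x\<close> e(1) by simp
    ultimately show ?thesis by (intro exI[of _ "\<phi> -` ball x e"] exI[of _ "real N * \<bar>C\<bar>"]) auto
  qed
  then obtain V C where VC: "\<And>v. v \<in> ?U \<Longrightarrow> open (V v) \<and> v \<in> V v \<and> C v \<ge> 0 \<and> (\<forall>y \<in> V v \<inter> ?U. ?B (C v) y)"
    by metis
  obtain I where I: "I \<subseteq> ?U" "finite I" "?U \<subseteq> (\<Union>v\<in>I. V v)"
    using compactE_image[OF compact_unitary_group, of ?U V] VC by blast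
  have "?B (1 + (\<Sum>v\<in>I. C v)) u" if u: "u \<in> ?U" for u
  proof -
    obtain v where v: "v \<in> I" "u \<in> V v" using I(3) u by blast
    then have "?B (C v) u" using VC I(1) u by blast
    moreover have "C v \<le> (\<Sum>v\<in>I. C v)" using v I VC by (intro member_le_sum) auto
    then have "C v \<le> 1 + (\<Sum>v\<in>I. C v)" by simp
    ultimately show ?thesis by (rule mono)
  qed
  moreover have "0 < 1 + (\<Sum>v\<in>I. C v)"
    using I(1) VC by (intro add_pos_nonneg sum_nonneg) auto
  ultimately show ?thesis by blast
qed

section \<open>Leading terms of intertwiners\<close>

definition degpart :: "nat \<Rightarrow> 'd::finite pseries \<Rightarrow> 'd pseries"
  where "degpart n f = (\<lambda>\<alpha>. if mlen \<alpha> = n then f \<alpha> else 0)"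

lemma degpart_H2: "degpart n f \<in> hcarrier (H2 \<beta>)"
  by (rule H2_finite_support, rule finite_subset[OF _ finite_mlen_eq[of n]]) (auto simp: degpart_def)

lemma degform_le_hnorm:
  assumes "f \<in> hcarrier (H2 \<beta>)"
  shows "degform (square_weight \<beta>) n f \<le> (hnorm (H2 \<beta>) f)\<^sup>2"
proof -
  have "degform (square_weight \<beta>) n f \<le> (\<Sum>m<Suc n. degform (square_weight \<beta>) m f)"
    by (intro member_le_sum) (auto intro!: degform_nonneg)
  then show ?thesis using H2_norm_le_iff[of f \<beta> "(hnorm (H2 \<beta>) f)\<^sup>2"] assms order_trans by blast
qed

lemma hnorm_degpart: "(hnorm (H2 \<beta>) (degpart n f))\<^sup>2 \<le> degform (square_weight \<beta>) n f"
proof -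
  have "(\<Sum>m<N. degform (square_weight \<beta>) m (degpart n f)) \<le> degform (square_weight \<beta>) n f" for N
  proof -
    have "(\<Sum>m<N. degform (square_weight \<beta>) m (degpart n f)) = (\<Sum>m<N. if m = n then degform (square_weight \<beta>) n f else 0)"
      by (intro sum.cong) (auto simp: degform_def degpart_def)
    then show ?thesis by (simp add: degform_nonneg)
  qed
  then show ?thesis using H2_norm_le_iff by blast
qed

lemma coefficient_le_hnorm:
  assumes "f \<in> hcarrier (H2 \<beta>)" "\<beta> \<alpha> \<ge> 0"
  shows "cmod (f \<alpha>) * \<beta> \<alpha> \<le> hnorm (H2 \<beta>) f"
proof -
  have "(\<Sum>\<gamma>\<in>{\<alpha>}. (cmod (f \<gamma>))\<^sup>2 * (\<beta> \<gamma>)\<^sup>2) \<le> (\<Sum>\<^sub>\<infinity>\<gamma>. (cmod (f \<gamma>))\<^sup>2 * (\<beta> \<gamma>)\<^sup>2)"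
    using assms by (intro finite_sum_le_infsum) (auto simp: in_H2_iff)
  then have "sqrt ((cmod (f \<alpha>) * \<beta> \<alpha>)\<^sup>2) \<le> hnorm (H2 \<beta>) f"
    unfolding hnorm_H2[OF assms(1)] by (intro real_sqrt_le_mono) (simp add: power_mult_distrib)
  then show ?thesis using assms(2) by simp
qed

text \<open>
  Density of the polynomials. It is needed once, in \<open>intertwiner_degree_bound\<close>, where an element
  obtained from surjectivity is not known to be a polynomial.
\<close>

lemma small_tail:
  assumes f: "f \<in> hcarrier (H2 \<beta>)" and "\<epsilon> > 0"
  obtains F where "finite F" "(\<lambda>\<alpha>. if \<alpha> \<in> F then 0 else f \<alpha>) \<in> hcarrier (H2 \<beta>)"
    "hnorm (H2 \<beta>) (\<lambda>\<alpha>. if \<alpha> \<in> F then 0 else f \<alpha>) \<le> \<epsilon>"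
proof -
  let ?g = "\<lambda>\<alpha>. (cmod (f \<alpha>))\<^sup>2 * (\<beta> \<alpha>)\<^sup>2"
  have sm: "?g summable_on UNIV" using f by (simp add: in_H2_iff)
  obtain F where F: "finite F" "dist (sum ?g F) (infsum ?g UNIV) \<le> \<epsilon>\<^sup>2"
    using has_sum_finite_approximation[OF has_sum_infsum[OF sm], of "\<epsilon>\<^sup>2"] assms(2) by auto
  let ?r = "\<lambda>\<alpha>. if \<alpha> \<in> F then 0 else f \<alpha>"
  have smF: "?g summable_on - F" using sm by (rule summable_on_subset_banach) simp
  have r: "?r \<in> hcarrier (H2 \<beta>)"
    unfolding in_H2_iff by (rule summable_on_comparison_test[OF sm]) auto
  have "infsum ?g UNIV = infsum ?g (F \<union> - F)" by (simp add: Un_commute)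
  also have "\<dots> = sum ?g F + infsum ?g (- F)"
    using F(1) smF by (subst infsum_Un_disjoint) (auto simp: summable_on_finite)
  finally have "infsum ?g (- F) \<le> \<epsilon>\<^sup>2" using F(2) by (auto simp: dist_real_def)
  moreover have "(\<Sum>\<^sub>\<infinity>\<alpha>. (cmod (?r \<alpha>))\<^sup>2 * (\<beta> \<alpha>)\<^sup>2) = infsum ?g (- F)"
    by (rule infsum_cong_neutral) auto
  ultimately have "hnorm (H2 \<beta>) ?r \<le> \<epsilon>"
    using assms(2) by (simp add: hnorm_H2[OF r] real_sqrt_le_iff' real_le_lsqrt)
  then show thesis using that F(1) r by blast
qed

lemma bounded_op_bound:
  assumes "bounded_op (H2 \<beta>) (H2 \<beta>') T"
  shows "\<exists>C>0. \<forall>f\<in>hcarrier (H2 \<beta>). hnorm (H2 \<beta>') (T f) \<le> C * hnorm (H2 \<beta>) f"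
proof -
  obtain C where C: "\<And>f. f \<in> hcarrier (H2 \<beta>) \<Longrightarrow> hnorm (H2 \<beta>') (T f) \<le> C * hnorm (H2 \<beta>) f"
    using assms unfolding bounded_op_def by blast
  show ?thesis
  proof (intro exI[of _ "max C 1"] conjI ballI)
    fix f assume f: "f \<in> hcarrier (H2 \<beta>)"
    have "C * hnorm (H2 \<beta>) f \<le> max C 1 * hnorm (H2 \<beta>) f"
      using hnorm_nonneg[OF f] by (intro mult_right_mono) auto
    then show "hnorm (H2 \<beta>') (T f) \<le> max C 1 * hnorm (H2 \<beta>) f" using C[OF f] by linarith
  qed simp
qed

text \<open>
  On polynomials \<open>\<Gamma> p = (C\<^sub>u p) \<Gamma> 1\<close>, because both sides satisfy the same recursion in the
  variables. Only the lowest degree of this product is used; there \<open>\<Gamma> 1\<close> contributes its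
  constant term.
\<close>

lemma intertwiner_leading_term:
  assumes lin: "linear_op (H2 \<beta>) (H2 \<beta>) \<Gamma>"
    and tw: "\<And>j f. f \<in> hcarrier (H2 \<beta>) \<Longrightarrow> \<Gamma> (Mz j f) = tuple_act u Mz j (\<Gamma> f)"
  shows "mlen \<gamma> = n \<Longrightarrow> \<Gamma> (degpart n f) \<gamma> = \<Gamma> (zmonom 0) 0 * comp_op u f \<gamma>"
    and "mlen \<gamma> < n \<Longrightarrow> \<Gamma> (degpart n f) \<gamma> = 0"
proof -
  have fin: "h \<in> hcarrier (H2 \<beta>)" if "\<And>\<alpha>. mlen \<alpha> \<noteq> m \<Longrightarrow> h \<alpha> = 0" for h and m
    by (rule H2_finite_support, rule finite_subset[OF _ finite_mlen_eq[of m]]) (use that in auto)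
  have "(\<forall>\<gamma>. mlen \<gamma> = n \<longrightarrow> \<Gamma> f \<gamma> = \<Gamma> (zmonom 0) 0 * comp_op u f \<gamma>) \<and> (\<forall>\<gamma>. mlen \<gamma> < n \<longrightarrow> \<Gamma> f \<gamma> = 0)"
    if "\<And>\<alpha>. mlen \<alpha> \<noteq> n \<Longrightarrow> f \<alpha> = 0" for f
    using that
  proof (induction n arbitrary: f)
    case 0
    have "f = (\<lambda>\<alpha>. f 0 * zmonom 0 \<alpha>)"
      using 0 by (auto simp: zmonom_def fun_eq_iff mlen_eq_0)
    moreover have "zmonom 0 \<in> hcarrier (H2 \<beta>)" by (rule fin[of 0]) (auto simp: zmonom_def mlen_def)
    ultimately have "\<Gamma> f = (\<lambda>k. f 0 * \<Gamma> (zmonom 0) k)" by (metis linear_opD(3)[OF lin])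
    then show ?case by (simp add: mlen_eq_0 comp_op_at_0)
  next
    case (Suc n)
    let ?h = "\<lambda>j. euler_part j f"
    have h0: "?h j \<alpha> = 0" if "mlen \<alpha> \<noteq> n" for j \<alpha>
      using Suc.prems[of "\<alpha> + axis j 1"] that by (simp add: euler_part_def pdiff_def mlen_add_axis)
    have IH: "\<And>j \<gamma>. mlen \<gamma> = n \<Longrightarrow> \<Gamma> (?h j) \<gamma> = \<Gamma> (zmonom 0) 0 * comp_op u (?h j) \<gamma>"
      "\<And>j \<gamma>. mlen \<gamma> < n \<Longrightarrow> \<Gamma> (?h j) \<gamma> = 0"
      using Suc.IH[of "?h _"] h0 by blast+
    have hH: "?h j \<in> hcarrier (H2 \<beta>)" for j by (rule fin[of n]) (rule h0)
    have MhH: "Mz j (?h j) \<in> hcarrier (H2 \<beta>)" for j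
    proof (rule fin[of "Suc n"])
      fix \<alpha> :: "nat ^ 'a" assume "mlen \<alpha> \<noteq> Suc n"
      then show "Mz j (?h j) \<alpha> = 0"
        using h0[of "\<alpha> - axis j 1" j] minus_axis_add[of \<alpha> j] mlen_add_axis[of "\<alpha> - axis j 1" j]
        by (auto simp: Mz_def)
    qed
    have f0: "f 0 = 0" using Suc.prems[of 0] by (simp add: mlen_def)
    have "f = (\<lambda>\<gamma>. \<Sum>j\<in>UNIV. Mz j (?h j) \<gamma>)"
      by (rule trans[OF euler_decomposition]) (simp add: f0)
    then have "\<Gamma> f = \<Gamma> (\<lambda>\<gamma>. \<Sum>j\<in>UNIV. Mz j (?h j) \<gamma>)" by (rule arg_cong)
    also have "\<dots> = (\<lambda>\<gamma>. \<Sum>j\<in>UNIV. \<Gamma> (Mz j (?h j)) \<gamma>)"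
      by (rule linear_op_sum[OF lin]) (auto simp: MhH)
    finally have \<Gamma>f: "\<Gamma> f \<gamma> = (\<Sum>j\<in>UNIV. \<Sum>k\<in>UNIV. u $ j $ k * Mz k (\<Gamma> (?h j)) \<gamma>)" for \<gamma>
      by (simp add: tw[OF hH] tuple_act_def)
    show ?case
    proof (intro conjI allI impI)
      fix \<gamma> :: "nat ^ 'a" assume \<gamma>: "mlen \<gamma> = Suc n"
      have "\<Gamma> f \<gamma> = (\<Sum>j\<in>UNIV. \<Sum>k\<in>UNIV. u $ j $ k * Mz k (\<lambda>\<alpha>. \<Gamma> (zmonom 0) 0 * comp_op u (?h j) \<alpha>) \<gamma>)"
        unfolding \<Gamma>f using \<gamma> IH(1) by (intro sum.cong refl arg_cong2[where f = "(*)"] Mz_cong) auto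
      also have "\<dots> = \<Gamma> (zmonom 0) 0 * comp_op u f \<gamma>"
        by (subst comp_op_euler) (simp add: f0 Mz_scale sum_distrib_left mult_ac)
      finally show "\<Gamma> f \<gamma> = \<Gamma> (zmonom 0) 0 * comp_op u f \<gamma>" .
    next
      fix \<gamma> :: "nat ^ 'a" assume \<gamma>: "mlen \<gamma> < Suc n"
      have "\<Gamma> f \<gamma> = (\<Sum>j\<in>UNIV. \<Sum>k\<in>UNIV. u $ j $ k * Mz k (\<lambda>_. 0) \<gamma>)"
        unfolding \<Gamma>f using \<gamma> IH(2) by (intro sum.cong refl arg_cong2[where f = "(*)"] Mz_cong) auto
      then show "\<Gamma> f \<gamma> = 0" by (simp add: Mz_def)
    qed
  qed
  note * = this[of "degpart n f"]
  show "mlen \<gamma> = n \<Longrightarrow> \<Gamma> (degpart n f) \<gamma> = \<Gamma> (zmonom 0) 0 * comp_op u f \<gamma>"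
    using * comp_op_cong[of \<gamma> "degpart n f" f u] by (auto simp: degpart_def)
  show "mlen \<gamma> < n \<Longrightarrow> \<Gamma> (degpart n f) \<gamma> = 0"
    using * by (auto simp: degpart_def)
qed

text \<open>
  By orthogonality of the degrees the leading term \<open>g C\<^sub>u f\<close> has norm at most \<open>\<parallel>\<Gamma> f\<parallel>\<close>. The constant
  \<open>g\<close> cannot vanish: otherwise \<open>\<Gamma>\<close> maps all polynomials, hence by continuity the whole space, into the
  series without constant term and misses \<open>1\<close>.
\<close>

lemma intertwiner_degree_bound:
  assumes \<beta>: "\<And>\<alpha>. \<beta> \<alpha> > 0" and inv: "invertible_op (H2 \<beta>) (H2 \<beta>) \<Gamma>"
    and tw: "\<And>j f. f \<in> hcarrier (H2 \<beta>) \<Longrightarrow> \<Gamma> (Mz j f) = tuple_act u Mz j (\<Gamma> f)"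
  shows "\<exists>C. \<forall>n f. degform (square_weight \<beta>) n (comp_op u f) \<le> C * degform (square_weight \<beta>) n f"
proof -
  obtain R where R: "bounded_op (H2 \<beta>) (H2 \<beta>) R" "\<And>g. g \<in> hcarrier (H2 \<beta>) \<Longrightarrow> \<Gamma> (R g) = g"
    using inv unfolding invertible_op_def by blast
  have bd: "bounded_op (H2 \<beta>) (H2 \<beta>) \<Gamma>" using inv unfolding invertible_op_def by blast
  then have lin: "linear_op (H2 \<beta>) (H2 \<beta>) \<Gamma>" unfolding bounded_op_def by blast
  obtain C where C: "C > 0" "\<And>f. f \<in> hcarrier (H2 \<beta>) \<Longrightarrow> hnorm (H2 \<beta>) (\<Gamma> f) \<le> C * hnorm (H2 \<beta>) f"
    using bounded_op_bound[OF bd] by blast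
  define g where "g = \<Gamma> (zmonom 0) 0"
  have lead: "mlen \<gamma> = n \<Longrightarrow> \<Gamma> (degpart n f) \<gamma> = g * comp_op u f \<gamma>"
    and low: "mlen \<gamma> < n \<Longrightarrow> \<Gamma> (degpart n f) \<gamma> = 0" for \<gamma> n f
    unfolding g_def by (rule intertwiner_leading_term[OF lin tw]; assumption)+
  have "g \<noteq> 0"
  proof
    assume g: "g = 0"
    have mon: "\<Gamma> (zmonom \<alpha>) 0 = 0" for \<alpha>
    proof -
      have "degpart (mlen \<alpha>) (zmonom \<alpha>) = zmonom \<alpha>" by (auto simp: degpart_def zmonom_def)
      then show ?thesis using lead[of 0 "mlen \<alpha>" "zmonom \<alpha>"] low[of 0 "mlen \<alpha>" "zmonom \<alpha>"] g
        by (cases "mlen \<alpha> = 0") (auto simp: mlen_def[of 0])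
    qed
    have zH: "zmonom \<alpha> \<in> hcarrier (H2 \<beta>)" for \<alpha> using hnorm_zmonom(1) \<beta> by blast
    \<comment> \<open>A preimage \<open>h\<close> of \<open>1\<close> has a small tail \<open>r\<close>, and the constant terms of \<open>\<Gamma> h\<close> and \<open>\<Gamma> r\<close>
      agree; but that of \<open>\<Gamma> h\<close> is \<open>1\<close> and that of \<open>\<Gamma> r\<close> is at most \<open>1/2\<close>.\<close>
    define h where "h = R (zmonom 0)"
    have h: "h \<in> hcarrier (H2 \<beta>)" "\<Gamma> h = zmonom 0"
      using R zH linear_opD(1)[of "H2 \<beta>" "H2 \<beta>" R] unfolding h_def bounded_op_def by blast+
    obtain F where F: "finite F" "(\<lambda>\<alpha>. if \<alpha> \<in> F then 0 else h \<alpha>) \<in> hcarrier (H2 \<beta>)"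
      "hnorm (H2 \<beta>) (\<lambda>\<alpha>. if \<alpha> \<in> F then 0 else h \<alpha>) \<le> \<beta> 0 / (2 * C)"
      using small_tail[OF h(1), of "\<beta> 0 / (2 * C)"] \<beta>[of 0] C(1) by auto
    let ?r = "\<lambda>\<alpha>. if \<alpha> \<in> F then 0 else h \<alpha>" and ?p = "\<lambda>\<gamma>. \<Sum>\<alpha>\<in>F. h \<alpha> * zmonom \<alpha> \<gamma>"
    have pH: "?p \<in> hcarrier (H2 \<beta>)" by (intro H2_sum F H2_scale zH)
    have "h = (\<lambda>\<gamma>. ?p \<gamma> + ?r \<gamma>)"
      using F(1) by (auto simp: zmonom_def fun_eq_iff if_distrib[of "\<lambda>x. _ * x"] cong: if_cong)
    then have "\<Gamma> h = \<Gamma> (\<lambda>\<gamma>. ?p \<gamma> + ?r \<gamma>)" by (rule arg_cong)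
    also have "\<dots> = (\<lambda>\<gamma>. \<Gamma> ?p \<gamma> + \<Gamma> ?r \<gamma>)" by (rule linear_opD(2)[OF lin pH F(2)])
    also have "\<Gamma> ?p = (\<lambda>\<gamma>. \<Sum>\<alpha>\<in>F. \<Gamma> (\<lambda>\<gamma>. h \<alpha> * zmonom \<alpha> \<gamma>) \<gamma>)"
      by (rule linear_op_sum[OF lin F(1)]) (intro H2_scale zH)
    also have "\<dots> = (\<lambda>\<gamma>. \<Sum>\<alpha>\<in>F. h \<alpha> * \<Gamma> (zmonom \<alpha>) \<gamma>)"
      by (simp add: linear_opD(3)[OF lin zH])
    finally have "\<Gamma> h 0 = \<Gamma> ?r 0" by (simp add: mon)
    then have r1: "\<Gamma> ?r 0 = 1" by (simp add: h(2) zmonom_def)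
    have "cmod (\<Gamma> ?r 0) * \<beta> 0 \<le> hnorm (H2 \<beta>) (\<Gamma> ?r)"
      using \<beta>[of 0] by (intro coefficient_le_hnorm linear_opD(1)[OF lin F(2)]) auto
    also have "\<dots> \<le> C * hnorm (H2 \<beta>) ?r" by (rule C(2)[OF F(2)])
    also have "\<dots> \<le> C * (\<beta> 0 / (2 * C))" using F(3) C(1) by (intro mult_left_mono) auto
    also have "\<dots> = \<beta> 0 / 2" using C(1) by simp
    finally show False using \<beta>[of 0] r1 by simp
  qed
  have "degform (square_weight \<beta>) n (comp_op u f) \<le> (C\<^sup>2 / (cmod g)\<^sup>2) * degform (square_weight \<beta>) n f" for n f
  proof -
    have "(cmod g)\<^sup>2 * degform (square_weight \<beta>) n (comp_op u f) = degform (square_weight \<beta>) n (\<Gamma> (degpart n f))"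
      by (simp add: degform_def sum_distrib_left lead norm_mult power_mult_distrib mult_ac)
    also have "\<dots> \<le> (hnorm (H2 \<beta>) (\<Gamma> (degpart n f)))\<^sup>2"
      by (intro degform_le_hnorm linear_opD(1)[OF lin] degpart_H2)
    also have "\<dots> \<le> (C * hnorm (H2 \<beta>) (degpart n f))\<^sup>2"
      by (intro power_mono C(2) degpart_H2 hnorm_nonneg linear_opD(1)[OF lin])
    also have "\<dots> \<le> C\<^sup>2 * degform (square_weight \<beta>) n f"
      unfolding power_mult_distrib by (intro mult_left_mono hnorm_degpart) simp
    finally show ?thesis using \<open>g \<noteq> 0\<close> by (simp add: field_simps)
  qed
  then show ?thesis by blast
qed

section \<open>Operator norms of the substitution operators\<close>

lemma linear_comp_op:
  assumes "\<And>f. f \<in> hcarrier (H2 \<beta>) \<Longrightarrow> comp_op u f \<in> hcarrier (H2 \<beta>')"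
  shows "linear_op (H2 \<beta>) (H2 \<beta>') (comp_op u)"
  using assms by (auto simp: linear_op_def comp_op_add comp_op_scale)

lemma hnorm_scale:
  assumes f: "f \<in> hcarrier (H2 \<beta>)"
  shows "hnorm (H2 \<beta>) (\<lambda>\<alpha>. c * f \<alpha>) = cmod c * hnorm (H2 \<beta>) f"
proof -
  have "(\<Sum>\<^sub>\<infinity>\<alpha>. (cmod (c * f \<alpha>))\<^sup>2 * (\<beta> \<alpha>)\<^sup>2) = (\<Sum>\<^sub>\<infinity>\<alpha>. (cmod c)\<^sup>2 * ((cmod (f \<alpha>))\<^sup>2 * (\<beta> \<alpha>)\<^sup>2))"
    by (simp add: norm_mult power_mult_distrib mult.assoc)
  also have "\<dots> = (cmod c)\<^sup>2 * (\<Sum>\<^sub>\<infinity>\<alpha>. (cmod (f \<alpha>))\<^sup>2 * (\<beta> \<alpha>)\<^sup>2)"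
    using f by (intro infsum_cmult_right) (simp add: in_H2_iff)
  finally show ?thesis
    by (simp add: hnorm_H2[OF f] hnorm_H2[OF H2_scale[OF f]] real_sqrt_mult)
qed

lemma hnorm_le_opnorm:
  assumes T: "bounded_op (H2 \<beta>) (H2 \<beta>') T" and f: "f \<in> hcarrier (H2 \<beta>)"
  shows "hnorm (H2 \<beta>') (T f) \<le> opnorm (H2 \<beta>) (H2 \<beta>') T * hnorm (H2 \<beta>) f"
proof -
  have lin: "linear_op (H2 \<beta>) (H2 \<beta>') T" using T by (simp add: bounded_op_def)
  obtain C where C: "C > 0" "\<And>f. f \<in> hcarrier (H2 \<beta>) \<Longrightarrow> hnorm (H2 \<beta>') (T f) \<le> C * hnorm (H2 \<beta>) f"
    using bounded_op_bound[OF T] by blast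
  let ?r = "hnorm (H2 \<beta>) f"
  show ?thesis
  proof (cases "?r = 0")
    case True
    then show ?thesis using C(2)[OF f] by simp
  next
    case False
    then have r: "?r > 0" using hnorm_nonneg[OF f] by simp
    let ?g = "\<lambda>\<alpha>. complex_of_real (1 / ?r) * f \<alpha>"
    have g: "?g \<in> hcarrier (H2 \<beta>)" by (rule H2_scale[OF f])
    have g1: "hnorm (H2 \<beta>) ?g = 1" unfolding hnorm_scale[OF f] using r by (simp add: norm_divide)
    have "hnorm (H2 \<beta>') (T ?g) \<le> opnorm (H2 \<beta>) (H2 \<beta>') T"
      unfolding opnorm_def
    proof (rule cSup_upper)
      show "hnorm (H2 \<beta>') (T ?g) \<in> {hnorm (H2 \<beta>') (T f) |f. f \<in> hcarrier (H2 \<beta>) \<and> hnorm (H2 \<beta>) f \<le> 1}"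
        using g g1 by auto
      show "bdd_above {hnorm (H2 \<beta>') (T f) |f. f \<in> hcarrier (H2 \<beta>) \<and> hnorm (H2 \<beta>) f \<le> 1}"
      proof (rule bdd_aboveI[of _ C])
        fix x assume "x \<in> {hnorm (H2 \<beta>') (T f) |f. f \<in> hcarrier (H2 \<beta>) \<and> hnorm (H2 \<beta>) f \<le> 1}"
        then obtain f where f: "f \<in> hcarrier (H2 \<beta>)" "hnorm (H2 \<beta>) f \<le> 1" "x = hnorm (H2 \<beta>') (T f)" by blast
        have "C * hnorm (H2 \<beta>) f \<le> C * 1" using f(2) C(1) by (intro mult_left_mono) auto
        then show "x \<le> C" using C(2)[OF f(1)] f(3) by simp
      qed
    qed
    moreover have "hnorm (H2 \<beta>') (T ?g) = hnorm (H2 \<beta>') (T f) / ?r"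
      unfolding linear_opD(3)[OF lin f] hnorm_scale[OF linear_opD(1)[OF lin f]]
      using r by (simp add: norm_divide)
    ultimately have "hnorm (H2 \<beta>') (T f) / ?r \<le> opnorm (H2 \<beta>) (H2 \<beta>') T" by (simp only:)
    then show ?thesis using r by (simp add: pos_divide_le_eq)
  qed
qed

text \<open>
  Restricting to one degree loses nothing, as the operator norm of \<open>C\<^sub>u\<close> is the supremum of its
  norms on the homogeneous components.
\<close>

lemma uniformly_bounded_iff:
  fixes \<beta> :: "nat ^ 'd::finite \<Rightarrow> real"
  shows "(\<forall>u \<in> unitary_group. bounded_op (H2 \<beta>) (H2 \<beta>) (comp_op u)) \<and>
      bdd_above ((\<lambda>u. opnorm (H2 \<beta>) (H2 \<beta>) (comp_op u)) ` unitary_group)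
    \<longleftrightarrow> (\<exists>K>0. \<forall>u\<in>unitary_group. \<forall>n f. degform (square_weight \<beta>) n (comp_op u f) \<le> K * degform (square_weight \<beta>) n f)"
    (is "?L \<longleftrightarrow> ?R")
proof
  assume L: ?L
  then obtain M where M: "\<And>u. u \<in> unitary_group \<Longrightarrow> opnorm (H2 \<beta>) (H2 \<beta>) (comp_op u) \<le> M"
    unfolding bdd_above_def by auto
  have "degform (square_weight \<beta>) n (comp_op u f) \<le> ((max M 1)\<^sup>2) * degform (square_weight \<beta>) n f"
    if u: "u \<in> unitary_group" for u n f
  proof -
    let ?f = "degpart n f"
    have bd: "bounded_op (H2 \<beta>) (H2 \<beta>) (comp_op u)" using L u by blast
    then have mem: "comp_op u ?f \<in> hcarrier (H2 \<beta>)"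
      using degpart_H2 unfolding bounded_op_def linear_op_def by blast
    have "hnorm (H2 \<beta>) (comp_op u ?f) \<le> opnorm (H2 \<beta>) (H2 \<beta>) (comp_op u) * hnorm (H2 \<beta>) ?f"
      by (rule hnorm_le_opnorm[OF bd degpart_H2])
    also have "\<dots> \<le> max M 1 * hnorm (H2 \<beta>) ?f"
      using M[OF u] by (intro mult_right_mono hnorm_nonneg degpart_H2) simp
    finally have le: "hnorm (H2 \<beta>) (comp_op u ?f) \<le> max M 1 * hnorm (H2 \<beta>) ?f" .
    have "degform (square_weight \<beta>) n (comp_op u f) = degform (square_weight \<beta>) n (comp_op u ?f)"
      by (intro degform_cong comp_op_cong) (simp add: degpart_def)
    also have "\<dots> \<le> (hnorm (H2 \<beta>) (comp_op u ?f))\<^sup>2" by (rule degform_le_hnorm[OF mem])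
    also have "\<dots> \<le> (max M 1 * hnorm (H2 \<beta>) ?f)\<^sup>2"
      by (intro power_mono le hnorm_nonneg mem)
    also have "\<dots> \<le> (max M 1)\<^sup>2 * degform (square_weight \<beta>) n f"
      unfolding power_mult_distrib by (intro mult_left_mono hnorm_degpart) simp
    finally show ?thesis .
  qed
  then show ?R by (intro exI[of _ "(max M 1)\<^sup>2"]) auto
next
  assume ?R
  then obtain K where K: "K > 0" "\<And>u n f. u \<in> unitary_group \<Longrightarrow>
      degform (square_weight \<beta>) n (comp_op u f) \<le> K * degform (square_weight \<beta>) n f" by blast
  have bd: "comp_op u f \<in> hcarrier (H2 \<beta>)" "hnorm (H2 \<beta>) (comp_op u f) \<le> sqrt K * hnorm (H2 \<beta>) f"
    if "u \<in> unitary_group" "f \<in> hcarrier (H2 \<beta>)" for u f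
    using degreewise_bound[OF that(2) less_imp_le[OF K(1)] K(2)[OF that(1)]] .
  have z: "(\<lambda>_. 0) \<in> hcarrier (H2 \<beta>)" by (rule H2_finite_support) simp
  have "opnorm (H2 \<beta>) (H2 \<beta>) (comp_op u) \<le> sqrt K" if u: "u \<in> unitary_group" for u
    unfolding opnorm_def
  proof (rule cSup_least)
    have "hnorm (H2 \<beta>) (\<lambda>_. 0) = 0" by (simp add: hnorm_H2[OF z])
    then show "{hnorm (H2 \<beta>) (comp_op u f) |f. f \<in> hcarrier (H2 \<beta>) \<and> hnorm (H2 \<beta>) f \<le> 1} \<noteq> {}"
      using z by fastforce
    fix x assume "x \<in> {hnorm (H2 \<beta>) (comp_op u f) |f. f \<in> hcarrier (H2 \<beta>) \<and> hnorm (H2 \<beta>) f \<le> 1}"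
    then obtain f where f: "f \<in> hcarrier (H2 \<beta>)" "hnorm (H2 \<beta>) f \<le> 1" "x = hnorm (H2 \<beta>) (comp_op u f)" by blast
    have "sqrt K * hnorm (H2 \<beta>) f \<le> sqrt K * 1" using f(2) K(1) by (intro mult_left_mono) auto
    then show "x \<le> sqrt K" using bd(2)[OF u f(1)] f(3) by simp
  qed
  moreover have "bounded_op (H2 \<beta>) (H2 \<beta>) (comp_op u)" if u: "u \<in> unitary_group" for u
    unfolding bounded_op_def using linear_comp_op bd[OF u] by blast
  ultimately show ?L
    by (auto intro!: bdd_aboveI[of _ "sqrt K"])
qed

section \<open>Homogeneous weights and similarity\<close>

text \<open>
  Two absolutely convergent sums with the same blocks of fixed degree agree, since the sets of
  multi-indices of degree less than \<open>N\<close> exhaust all finite sets.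
\<close>

lemma infsum_by_degree:
  fixes F G :: "nat ^ 'd::finite \<Rightarrow> complex"
  assumes "F summable_on UNIV" "G summable_on UNIV"
    and eq: "\<And>n. (\<Sum>\<alpha> | mlen \<alpha> = n. F \<alpha>) = (\<Sum>\<alpha> | mlen \<alpha> = n. G \<alpha>)"
  shows "infsum F UNIV = infsum G UNIV"
proof -
  have flt: "filterlim (\<lambda>N. {\<alpha> :: nat ^ 'd. mlen \<alpha> < N}) (finite_subsets_at_top UNIV) sequentially"
    unfolding filterlim_finite_subsets_at_top
  proof (intro allI impI)
    fix X :: "(nat ^ 'd) set" assume "finite X \<and> X \<subseteq> UNIV"
    then obtain M where M: "X \<subseteq> {\<alpha>. mlen \<alpha> < M}" using finite_subset_mlen_less by blast
    show "\<forall>\<^sub>F N in sequentially. finite {\<alpha> :: nat ^ 'd. mlen \<alpha> < N} \<and> X \<subseteq> {\<alpha>. mlen \<alpha> < N} \<and> {\<alpha> :: nat ^ 'd. mlen \<alpha> < N} \<subseteq> UNIV"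
      using eventually_ge_at_top[of M]
      by eventually_elim (use M in \<open>auto simp: finite_mlen_less intro: less_le_trans\<close>)
  qed
  have lim: "(\<lambda>N. \<Sum>n<N. \<Sum>\<alpha> | mlen \<alpha> = n. F \<alpha>) \<longlonglongrightarrow> infsum F UNIV"
    if "F summable_on UNIV" for F :: "nat ^ 'd \<Rightarrow> complex"
    using filterlim_compose[OF has_sum_infsum[OF that, unfolded has_sum_def] flt]
    by (simp add: sum_by_degree)
  show ?thesis
    using LIMSEQ_unique[OF lim[OF assms(1)]] lim[OF assms(2)] eq by simp
qed

lemma H2_inner_summable:
  assumes "f \<in> hcarrier (H2 \<beta>)" "g \<in> hcarrier (H2 \<beta>)"
  shows "(\<lambda>\<alpha>. f \<alpha> * cnj (g \<alpha>) * (complex_of_real (\<beta> \<alpha>))\<^sup>2) summable_on UNIV"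
proof -
  have "(\<lambda>\<alpha>. (cmod (f \<alpha>))\<^sup>2 * (\<beta> \<alpha>)\<^sup>2 + (cmod (g \<alpha>))\<^sup>2 * (\<beta> \<alpha>)\<^sup>2) summable_on UNIV"
    using assms unfolding in_H2_iff by (rule summable_on_add)
  then have "(\<lambda>\<alpha>. norm (f \<alpha> * cnj (g \<alpha>) * (complex_of_real (\<beta> \<alpha>))\<^sup>2)) summable_on UNIV"
  proof (rule summable_on_comparison_test)
    fix \<alpha>
    have "cmod (f \<alpha>) * cmod (g \<alpha>) \<le> (cmod (f \<alpha>))\<^sup>2 + (cmod (g \<alpha>))\<^sup>2"
    proof -
      have "0 \<le> cmod (f \<alpha>) * cmod (g \<alpha>)" by simp
      then show ?thesis
        using sum_squares_bound[of "cmod (f \<alpha>)" "cmod (g \<alpha>)"] unfolding mult.assoc by linarith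
    qed
    then have "cmod (f \<alpha>) * cmod (g \<alpha>) * (\<beta> \<alpha>)\<^sup>2 \<le> ((cmod (f \<alpha>))\<^sup>2 + (cmod (g \<alpha>))\<^sup>2) * (\<beta> \<alpha>)\<^sup>2"
      by (rule mult_right_mono) simp
    then show "norm (f \<alpha> * cnj (g \<alpha>) * (complex_of_real (\<beta> \<alpha>))\<^sup>2)
        \<le> (cmod (f \<alpha>))\<^sup>2 * (\<beta> \<alpha>)\<^sup>2 + (cmod (g \<alpha>))\<^sup>2 * (\<beta> \<alpha>)\<^sup>2"
      by (simp add: norm_mult norm_power distrib_right)
  qed simp
  then show ?thesis by (rule abs_summable_summable)
qed

text \<open>
  A weight that is a multiple of \<open>\<alpha>!\<close> in each degree, with a factor depending on the degree only,
  inherits the invariance of the Fock form.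
\<close>

lemma comp_op_unitary:
  fixes \<beta> :: "nat ^ 'd::finite \<Rightarrow> real"
  assumes \<beta>: "\<And>\<alpha>. (\<beta> \<alpha>)\<^sup>2 = c (mlen \<alpha>) * mfact \<alpha>"
    and u: "u \<in> unitary_group"
  shows "unitary_op (H2 \<beta>) (H2 \<beta>) (comp_op u)"
proof -
  have deg: "degform (square_weight \<beta>) n f = c n * degform mfact n f" for n f
    by (simp add: degform_def \<beta> sum_distrib_left mult.assoc)
  have mem: "comp_op v f \<in> hcarrier (H2 \<beta>)" if "v \<in> unitary_group" "f \<in> hcarrier (H2 \<beta>)" for v f
    by (rule degreewise_bound(1)[OF that(2), of 1]) (simp_all add: deg degform_mfact_comp_op that(1))
  have "hinner (H2 \<beta>) (comp_op u f) (comp_op u g) = hinner (H2 \<beta>) f g"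
    if f: "f \<in> hcarrier (H2 \<beta>)" and g: "g \<in> hcarrier (H2 \<beta>)" for f g
  proof -
    have fk: "(\<Sum>\<alpha> | mlen \<alpha> = n. f \<alpha> * cnj (g \<alpha>) * (complex_of_real (\<beta> \<alpha>))\<^sup>2) = of_real (c n) * fock n f g" for n f g
      unfolding fock_def sum_distrib_left
      by (intro sum.cong) (auto simp: \<beta> simp flip: of_real_power)
    show ?thesis
      unfolding H2_def hspace.simps
      by (rule infsum_by_degree) (auto intro!: H2_inner_summable mem u f g simp: fk fock_comp_op[OF u])
  qed
  moreover have "comp_op u ` hcarrier (H2 \<beta>) = hcarrier (H2 \<beta>)"
  proof
    show "hcarrier (H2 \<beta>) \<subseteq> comp_op u ` hcarrier (H2 \<beta>)"
    proof
      fix f assume "f \<in> hcarrier (H2 \<beta>)"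
      then show "f \<in> comp_op u ` hcarrier (H2 \<beta>)"
        using comp_op_adj(1)[OF u, of f] mem[OF unitary_adj[OF u]] by (metis image_eqI)
    qed
  qed (use mem[OF u] in auto)
  ultimately show ?thesis
    unfolding unitary_op_def using linear_comp_op mem[OF u] by blast
qed

lemma H2_id_bounded:
  assumes pos: "\<And>\<alpha>. \<beta> \<alpha> \<ge> 0" "\<And>\<alpha>. \<beta>' \<alpha> \<ge> 0"
    and L: "L \<ge> 0" "\<And>\<alpha>. \<beta>' \<alpha> \<le> L * \<beta> \<alpha>"
  shows "bounded_op (H2 \<beta>) (H2 \<beta>') (\<lambda>f. f)"
proof -
  have "degform (square_weight \<beta>') n f \<le> L\<^sup>2 * degform (square_weight \<beta>) n f" for n f
    unfolding degform_def sum_distrib_left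
  proof (intro sum_mono)
    fix \<alpha>
    have "(\<beta>' \<alpha>)\<^sup>2 \<le> (L * \<beta> \<alpha>)\<^sup>2" using L pos by (intro power_mono) auto
    then have "(\<beta>' \<alpha>)\<^sup>2 * (cmod (f \<alpha>))\<^sup>2 \<le> (L * \<beta> \<alpha>)\<^sup>2 * (cmod (f \<alpha>))\<^sup>2" by (intro mult_right_mono) auto
    then show "(\<beta>' \<alpha>)\<^sup>2 * (cmod (f \<alpha>))\<^sup>2 \<le> L\<^sup>2 * ((\<beta> \<alpha>)\<^sup>2 * (cmod (f \<alpha>))\<^sup>2)"
      by (simp add: power_mult_distrib mult.assoc)
  qed
  from degreewise_bound[OF _ zero_le_power2 this] show ?thesis
    unfolding bounded_op_def linear_op_def by blast
qed

lemma bounded_op_compose: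
  fixes \<beta>1 \<beta>2 \<beta>3 :: "nat ^ 'd::finite \<Rightarrow> real"
  assumes "bounded_op (H2 \<beta>1) (H2 \<beta>2) S" "bounded_op (H2 \<beta>2) (H2 \<beta>3) T"
  shows "bounded_op (H2 \<beta>1) (H2 \<beta>3) (\<lambda>f. T (S f))"
proof -
  have lin: "linear_op (H2 \<beta>1) (H2 \<beta>2) S" "linear_op (H2 \<beta>2) (H2 \<beta>3) T"
    using assms by (auto simp: bounded_op_def)
  obtain C where C: "C > 0" "\<And>f. f \<in> hcarrier (H2 \<beta>1) \<Longrightarrow> hnorm (H2 \<beta>2) (S f) \<le> C * hnorm (H2 \<beta>1) f"
    using bounded_op_bound[OF assms(1)] by blast
  obtain D where D: "D > 0" "\<And>f. f \<in> hcarrier (H2 \<beta>2) \<Longrightarrow> hnorm (H2 \<beta>3) (T f) \<le> D * hnorm (H2 \<beta>2) f"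
    using bounded_op_bound[OF assms(2)] by blast
  have "linear_op (H2 \<beta>1) (H2 \<beta>3) (\<lambda>f. T (S f))"
    unfolding linear_op_def using linear_opD[OF lin(1)] linear_opD[OF lin(2)] by simp
  moreover have "hnorm (H2 \<beta>3) (T (S f)) \<le> (D * C) * hnorm (H2 \<beta>1) f" if f: "f \<in> hcarrier (H2 \<beta>1)" for f
  proof -
    have "hnorm (H2 \<beta>3) (T (S f)) \<le> D * hnorm (H2 \<beta>2) (S f)" by (rule D(2)[OF linear_opD(1)[OF lin(1) f]])
    also have "\<dots> \<le> D * (C * hnorm (H2 \<beta>1) f)" using C(2)[OF f] D(1) by (intro mult_left_mono) auto
    finally show ?thesis by (simp add: mult.assoc)
  qed
  ultimately show ?thesis unfolding bounded_op_def by blast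
qed

lemma H2_definite:
  assumes "\<And>\<alpha>. \<beta> \<alpha> > 0" "f \<in> hcarrier (H2 \<beta>)" "hnorm (H2 \<beta>) f = 0"
  shows "f = (\<lambda>_. 0)"
proof
  fix \<alpha>
  have "cmod (f \<alpha>) * \<beta> \<alpha> \<le> 0"
    using coefficient_le_hnorm[of f \<beta> \<alpha>] assms less_imp_le by metis
  then show "f \<alpha> = 0"
    using assms(1)[of \<alpha>] by (simp add: mult_le_0_iff)
qed

lemma unitary_imp_invertible:
  assumes \<beta>: "\<And>\<alpha>. \<beta> \<alpha> > 0" and V: "unitary_op (H2 \<beta>) (H2 \<beta>) V"
  shows "invertible_op (H2 \<beta>) (H2 \<beta>) V"
proof -
  let ?H = "hcarrier (H2 \<beta>)"
  have lin: "linear_op (H2 \<beta>) (H2 \<beta>) V" and onto: "V ` ?H = ?H"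
    and iso: "\<And>f. f \<in> ?H \<Longrightarrow> hnorm (H2 \<beta>) (V f) = hnorm (H2 \<beta>) f"
    using V by (auto simp: unitary_op_def hnorm_def)
  have inj: "f = g" if f: "f \<in> ?H" and g: "g \<in> ?H" and eq: "V f = V g" for f g
  proof -
    have ng: "(\<lambda>\<alpha>. -1 * g \<alpha>) \<in> ?H" by (rule H2_scale[OF g])
    have d: "(\<lambda>\<alpha>. f \<alpha> + -1 * g \<alpha>) \<in> ?H" by (rule H2_add[OF f ng])
    have "V (\<lambda>\<alpha>. f \<alpha> + -1 * g \<alpha>) = (\<lambda>\<alpha>. 0)"
      unfolding linear_opD(2)[OF lin f ng] linear_opD(3)[OF lin g] eq by simp
    moreover have "hnorm (H2 \<beta>) (\<lambda>_. 0) = 0"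
      using hnorm_scale[OF f, of 0] by simp
    ultimately have "(\<lambda>\<alpha>. f \<alpha> + -1 * g \<alpha>) = (\<lambda>_. 0)"
      using iso[OF d] by (intro H2_definite[OF \<beta> d]) simp
    then show ?thesis by (simp add: fun_eq_iff)
  qed
  define R where "R = inv_into ?H V"
  have RV: "V (R g) = g" "R g \<in> ?H" if "g \<in> ?H" for g
    unfolding R_def using that onto by (metis f_inv_into_f, metis inv_into_into)
  have VR: "R (V f) = f" if "f \<in> ?H" for f
    using that RV linear_opD(1)[OF lin that] inj by blast
  have "linear_op (H2 \<beta>) (H2 \<beta>) R"
    unfolding linear_op_def
  proof (intro conjI ballI allI)
    fix f g c assume f: "f \<in> ?H"
    show "R f \<in> ?H" by (rule RV(2)[OF f])
    show "R (\<lambda>i. c * f i) = (\<lambda>k. c * R f k)"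
      using linear_opD(3)[OF lin RV(2)[OF f], of c] RV(1)[OF f] VR[OF H2_scale[OF RV(2)[OF f], of c]] by simp
    assume g: "g \<in> ?H"
    show "R (\<lambda>i. f i + g i) = (\<lambda>k. R f k + R g k)"
      using linear_opD(2)[OF lin RV(2)[OF f] RV(2)[OF g]] RV(1)[OF f] RV(1)[OF g]
        VR[OF H2_add[OF RV(2)[OF f] RV(2)[OF g]]] by simp
  qed
  moreover have "hnorm (H2 \<beta>) (R g) \<le> 1 * hnorm (H2 \<beta>) g" if "g \<in> ?H" for g
    using iso[OF RV(2)[OF that]] RV(1)[OF that] by simp
  ultimately have "bounded_op (H2 \<beta>) (H2 \<beta>) R" unfolding bounded_op_def by blast
  moreover have "bounded_op (H2 \<beta>) (H2 \<beta>) V"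
    unfolding bounded_op_def using lin iso by (intro conjI exI[of _ 1]) auto
  ultimately show ?thesis
    unfolding invertible_op_def using RV VR by blast
qed

text \<open>
  If \<open>S\<close> is a similarity and \<open>V\<close> a unitary intertwiner for \<open>u\<close>, then \<open>S\<^sup>-\<^sup>1 V S\<close> is a bounded
  invertible intertwiner for \<open>u\<close>.
\<close>

lemma homogeneous_similar_imp_weakly:
  fixes \<beta> \<beta>' :: "nat ^ 'd::finite \<Rightarrow> real"
  assumes \<beta>': "\<And>\<alpha>. \<beta>' \<alpha> > 0"
    and bdd: "bounded_tuple (H2 \<beta>) (Mz :: ('d, nat ^ 'd) op_tuple)"
    and hom: "homogeneous (H2 \<beta>') (Mz :: ('d, nat ^ 'd) op_tuple)"
    and sim: "similar_tuples (H2 \<beta>) (Mz :: ('d, nat ^ 'd) op_tuple) (H2 \<beta>') Mz"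
  shows "weakly_homogeneous (H2 \<beta>) (Mz :: ('d, nat ^ 'd) op_tuple)"
proof -
  let ?H = "hcarrier (H2 \<beta>)" and ?K = "hcarrier (H2 \<beta>')"
  obtain S R where S: "bounded_op (H2 \<beta>) (H2 \<beta>') S" "\<And>j f. f \<in> ?H \<Longrightarrow> S (Mz j f) = Mz j (S f)"
    and R: "bounded_op (H2 \<beta>') (H2 \<beta>) R" "\<And>f. f \<in> ?H \<Longrightarrow> R (S f) = f" "\<And>g. g \<in> ?K \<Longrightarrow> S (R g) = g"
    using sim unfolding similar_tuples_def invertible_op_def by blast
  have linR: "linear_op (H2 \<beta>') (H2 \<beta>) R" and linS: "linear_op (H2 \<beta>) (H2 \<beta>') S"
    using R(1) S(1) by (auto simp: bounded_op_def)
  have MzH: "Mz j f \<in> ?H" if "f \<in> ?H" for j f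
    using bdd that unfolding bounded_tuple_def bounded_op_def linear_op_def by blast
  have MzK: "Mz j f \<in> ?K" if "f \<in> ?K" for j f
    using hom that unfolding homogeneous_def bounded_tuple_def bounded_op_def linear_op_def by blast
  have RMz: "R (Mz j g) = Mz j (R g)" if g: "g \<in> ?K" for j g
  proof -
    have "R (Mz j (S (R g))) = R (S (Mz j (R g)))" by (simp only: S(2)[OF linear_opD(1)[OF linR g]])
    then show ?thesis using R(2)[OF MzH[OF linear_opD(1)[OF linR g]]] R(3)[OF g] by simp
  qed
  have "\<exists>\<Gamma>. invertible_op (H2 \<beta>) (H2 \<beta>) \<Gamma> \<and> (\<forall>j. \<forall>f \<in> ?H. \<Gamma> (Mz j f) = tuple_act u Mz j (\<Gamma> f))"
    if u: "u \<in> unitary_group" for u :: "complex ^ 'd ^ 'd"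
  proof -
    obtain V where V: "unitary_op (H2 \<beta>') (H2 \<beta>') V" "\<And>j f. f \<in> ?K \<Longrightarrow> V (Mz j f) = tuple_act u Mz j (V f)"
      using hom u unfolding homogeneous_def by blast
    obtain W where W: "bounded_op (H2 \<beta>') (H2 \<beta>') V" "bounded_op (H2 \<beta>') (H2 \<beta>') W"
      "\<And>f. f \<in> ?K \<Longrightarrow> W (V f) = f" "\<And>f. f \<in> ?K \<Longrightarrow> V (W f) = f"
      using unitary_imp_invertible[OF \<beta>' V(1)] unfolding invertible_op_def by blast
    have SK: "S f \<in> ?K" if "f \<in> ?H" for f by (rule linear_opD(1)[OF linS that])
    have VK: "V f \<in> ?K" "W f \<in> ?K" if "f \<in> ?K" for f
      using W(1,2) that unfolding bounded_op_def linear_op_def by blast+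
    let ?\<Gamma> = "\<lambda>f. R (V (S f))" and ?\<Lambda> = "\<lambda>f. R (W (S f))"
    have "bounded_op (H2 \<beta>) (H2 \<beta>) ?\<Gamma>" "bounded_op (H2 \<beta>) (H2 \<beta>) ?\<Lambda>"
      by (intro bounded_op_compose[OF bounded_op_compose[OF S(1)] R(1)] W)+
    moreover have "?\<Lambda> (?\<Gamma> f) = f" "?\<Gamma> (?\<Lambda> f) = f" if "f \<in> ?H" for f
      using that by (simp_all add: R(2,3) W(3,4) VK SK)
    ultimately have "invertible_op (H2 \<beta>) (H2 \<beta>) ?\<Gamma>"
      unfolding invertible_op_def by blast
    moreover have "?\<Gamma> (Mz j f) = tuple_act u Mz j (?\<Gamma> f)" if f: "f \<in> ?H" for j f
    proof -
      have VS: "V (S f) \<in> ?K" by (intro VK SK f)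
      have "?\<Gamma> (Mz j f) = R (\<lambda>\<alpha>. \<Sum>k\<in>UNIV. u $ j $ k * Mz k (V (S f)) \<alpha>)"
        by (simp add: S(2)[OF f] V(2)[OF SK[OF f]] tuple_act_def)
      also have "\<dots> = (\<lambda>\<alpha>. \<Sum>k\<in>UNIV. R (\<lambda>\<alpha>. u $ j $ k * Mz k (V (S f)) \<alpha>) \<alpha>)"
        by (rule linear_op_sum[OF linR]) (auto intro!: H2_scale MzK VS)
      also have "\<dots> = tuple_act u Mz j (?\<Gamma> f)"
        by (simp add: linear_opD(3)[OF linR MzK[OF VS]] RMz[OF VS] tuple_act_def)
      finally show ?thesis .
    qed
    ultimately show ?thesis by (intro exI[of _ ?\<Gamma>]) blast
  qed
  then show ?thesis
    using bdd commuting_Mz unfolding weakly_homogeneous_def by blast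
qed

text \<open>
  The identity map is the similarity. The factor \<open>m n\<close> may be any of the quotients
  \<open>\<beta>\<^sub>\<alpha> / \<surd>\<alpha>!\<close> of degree \<open>n\<close>, as all of them are comparable; the pure power of one variable is
  chosen. Boundedness of \<open>M\<^sub>z\<close> carries over because the norms are equivalent.
\<close>

lemma comparable_imp_similar_homogeneous:
  fixes \<beta> :: "nat ^ 'd::finite \<Rightarrow> real"
  assumes \<beta>: "\<And>\<alpha>. \<beta> \<alpha> > 0"
    and bdd: "bounded_tuple (H2 \<beta>) (Mz :: ('d, nat ^ 'd) op_tuple)"
    and L: "\<And>\<alpha> \<delta>. mlen \<alpha> = mlen \<delta> \<Longrightarrow> \<beta> \<alpha> / sqrt (mfact \<alpha>) * (sqrt (mfact \<delta>) / \<beta> \<delta>) \<le> L"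
  shows "\<exists>\<beta>' :: nat ^ 'd \<Rightarrow> real. (\<forall>\<alpha>. \<beta>' \<alpha> > 0) \<and>
        homogeneous (H2 \<beta>') (Mz :: ('d, nat ^ 'd) op_tuple) \<and>
        similar_tuples (H2 \<beta>) (Mz :: ('d, nat ^ 'd) op_tuple) (H2 \<beta>') Mz"
proof -
  have sq: "sqrt (mfact \<alpha>) > 0" for \<alpha> :: "nat ^ 'd" using mfact_pos by simp
  define m where "m n = \<beta> (axis undefined n) / sqrt (mfact (axis undefined n :: nat ^ 'd))" for n
  define \<beta>' where "\<beta>' \<alpha> = m (mlen \<alpha>) * sqrt (mfact \<alpha>)" for \<alpha> :: "nat ^ 'd"
  have len: "mlen (axis undefined n :: nat ^ 'd) = n" for n by (simp add: mlen_def axis_def)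
  have m: "m n > 0" for n unfolding m_def by (intro divide_pos_pos \<beta> sq)
  have \<beta>': "\<beta>' \<alpha> > 0" for \<alpha> unfolding \<beta>'_def by (intro mult_pos_pos m sq)
  have up: "\<beta>' \<alpha> \<le> L * \<beta> \<alpha>" for \<alpha>
  proof -
    have "m (mlen \<alpha>) * (sqrt (mfact \<alpha>) / \<beta> \<alpha>) \<le> L"
      using L[of "axis undefined (mlen \<alpha>)" \<alpha>] by (simp only: len m_def)
    then show ?thesis
      using \<beta>[of \<alpha>] by (simp add: \<beta>'_def pos_divide_le_eq)
  qed
  have lo: "\<beta> \<alpha> \<le> L * \<beta>' \<alpha>" for \<alpha>
  proof -
    have "\<beta> \<alpha> / sqrt (mfact \<alpha>) / m (mlen \<alpha>) \<le> L"
      using L[of \<alpha> "axis undefined (mlen \<alpha>)"] by (simp add: len m_def)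
    then show ?thesis
      using m[of "mlen \<alpha>"] sq[of \<alpha>] by (simp add: \<beta>'_def field_simps)
  qed
  have L0: "L \<ge> 0"
    using up[of 0] \<beta>[of 0] \<beta>'[of 0] by (metis less_le_trans less_imp_le zero_less_mult_pos2)
  have id: "bounded_op (H2 \<beta>) (H2 \<beta>') (\<lambda>f. f)" "bounded_op (H2 \<beta>') (H2 \<beta>) (\<lambda>f. f)"
    by (rule H2_id_bounded[OF _ _ L0]; use \<beta> \<beta>' up lo less_imp_le in blast)+
  have "bounded_tuple (H2 \<beta>') (Mz :: ('d, nat ^ 'd) op_tuple)"
    unfolding bounded_tuple_def
  proof
    fix j
    have Mj: "bounded_op (H2 \<beta>) (H2 \<beta>) (Mz j)" using bdd by (simp add: bounded_tuple_def)
    show "bounded_op (H2 \<beta>') (H2 \<beta>') (Mz j)"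
      using bounded_op_compose[OF bounded_op_compose[OF id(2) Mj] id(1)] .
  qed
  moreover have "\<exists>V. unitary_op (H2 \<beta>') (H2 \<beta>') V \<and>
       (\<forall>j. \<forall>f \<in> hcarrier (H2 \<beta>'). V (Mz j f) = tuple_act u Mz j (V f))"
    if "u \<in> unitary_group" for u :: "complex ^ 'd ^ 'd"
  proof (intro exI[of _ "comp_op u"] conjI allI ballI)
    have "(\<beta>' \<alpha>)\<^sup>2 = (m (mlen \<alpha>))\<^sup>2 * mfact \<alpha>" for \<alpha>
      using mfact_pos[of \<alpha>] by (simp add: \<beta>'_def power_mult_distrib)
    then show "unitary_op (H2 \<beta>') (H2 \<beta>') (comp_op u)"
      by (rule comp_op_unitary[where c = "\<lambda>n. (m n)\<^sup>2"]) fact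
    show "comp_op u (Mz j f) = tuple_act u Mz j (comp_op u f)" for j f
      by (simp add: tuple_act_def comp_op_Mz fun_eq_iff)
  qed
  ultimately have "homogeneous (H2 \<beta>') (Mz :: ('d, nat ^ 'd) op_tuple)"
    unfolding homogeneous_def using commuting_Mz by blast
  moreover have "invertible_op (H2 \<beta>) (H2 \<beta>') (\<lambda>f. f)"
    unfolding invertible_op_def using id by blast
  then have "similar_tuples (H2 \<beta>) (Mz :: ('d, nat ^ 'd) op_tuple) (H2 \<beta>') Mz"
    unfolding similar_tuples_def by (intro exI[of _ "\<lambda>f. f"]) simp
  ultimately show ?thesis using \<beta>' by blast
qed

section \<open>The equivalence\<close>

text \<open>
  The product of the two maxima in degree \<open>n\<close> is the largest product of a pair of entries, one from
  each, as all entries are positive.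
\<close>

lemma max_condition_iff:
  fixes \<beta> :: "nat ^ 'd::finite \<Rightarrow> real"
  assumes \<beta>: "\<And>\<alpha>. \<beta> \<alpha> > 0"
  shows "bdd_above (range (\<lambda>n.
        Max ((\<lambda>\<alpha>. hnorm (H2 \<beta>) (zmonom \<alpha>) / sqrt (mfact \<alpha>)) ` {\<alpha>. mlen \<alpha> = n}) *
        Max ((\<lambda>\<delta>. sqrt (mfact \<delta>) / hnorm (H2 \<beta>) (zmonom \<delta>)) ` {\<delta>. mlen \<delta> = n})))
    \<longleftrightarrow> (\<exists>L. \<forall>\<alpha> \<delta>. mlen \<alpha> = mlen \<delta> \<longrightarrow> \<beta> \<alpha> / sqrt (mfact \<alpha>) * (sqrt (mfact \<delta>) / \<beta> \<delta>) \<le> L)"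
    (is "?L \<longleftrightarrow> ?R")
proof -
  let ?p = "\<lambda>\<alpha>. \<beta> \<alpha> / sqrt (mfact \<alpha>)" and ?q = "\<lambda>\<alpha>. sqrt (mfact \<alpha>) / \<beta> \<alpha>"
  define I where "I n = {\<alpha> :: nat ^ 'd. mlen \<alpha> = n}" for n
  have I: "finite (I n)" "I n \<noteq> {}" for n
    using finite_mlen_eq ex_mlen_eq unfolding I_def by auto
  have sq: "sqrt (mfact \<alpha>) > 0" for \<alpha> :: "nat ^ 'd" using mfact_pos by simp
  have pos: "?p \<alpha> > 0" "?q \<alpha> > 0" for \<alpha> by (intro divide_pos_pos \<beta> sq)+
  have "?L \<longleftrightarrow> bdd_above (range (\<lambda>n. Max (?p ` I n) * Max (?q ` I n)))"
    unfolding I_def by (simp only: hnorm_zmonom(2)[OF \<beta>])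
  also have "\<dots> \<longleftrightarrow> ?R"
  proof
    assume "bdd_above (range (\<lambda>n. Max (?p ` I n) * Max (?q ` I n)))"
    then obtain L where L: "\<And>n. Max (?p ` I n) * Max (?q ` I n) \<le> L" unfolding bdd_above_def by auto
    have "?p \<alpha> * ?q \<delta> \<le> L" if "mlen \<alpha> = mlen \<delta>" for \<alpha> \<delta>
    proof -
      have mem: "\<alpha> \<in> I (mlen \<alpha>)" "\<delta> \<in> I (mlen \<alpha>)" using that by (simp_all add: I_def)
      have le: "?p \<alpha> \<le> Max (?p ` I (mlen \<alpha>))" "?q \<delta> \<le> Max (?q ` I (mlen \<alpha>))"
        using mem I by (auto intro!: Max_ge)
      then have "?p \<alpha> * ?q \<delta> \<le> Max (?p ` I (mlen \<alpha>)) * Max (?q ` I (mlen \<alpha>))"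
        using pos[of \<alpha>] pos[of \<delta>] by (intro mult_mono) linarith+
      then show ?thesis using L[of "mlen \<alpha>"] by linarith
    qed
    then show ?R by blast
  next
    assume ?R
    then obtain L where L: "\<And>\<alpha> \<delta>. mlen \<alpha> = mlen \<delta> \<Longrightarrow> ?p \<alpha> * ?q \<delta> \<le> L" by blast
    have "Max (?p ` I n) * Max (?q ` I n) \<le> L" for n
    proof -
      have "Max (?p ` I n) \<in> ?p ` I n" "Max (?q ` I n) \<in> ?q ` I n" using I by (auto intro!: Max_in)
      then obtain \<alpha> \<delta> where "\<alpha> \<in> I n" "\<delta> \<in> I n" "Max (?p ` I n) = ?p \<alpha>" "Max (?q ` I n) = ?q \<delta>" by blast
      then show ?thesis using L[of \<alpha> \<delta>] by (simp add: I_def)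
    qed
    then show "bdd_above (range (\<lambda>n. Max (?p ` I n) * Max (?q ` I n)))"
      by (intro bdd_aboveI[of _ L]) auto
  qed
  finally show ?thesis .
qed

lemma uniform_bound_imp_comparable:
  fixes \<beta> :: "nat ^ 'd::finite \<Rightarrow> real"
  assumes \<beta>: "\<And>\<alpha>. \<beta> \<alpha> > 0" and K: "K > 0"
    and bound: "\<And>u n f. u \<in> unitary_group \<Longrightarrow> degform (square_weight \<beta>) n (comp_op u f) \<le> K * degform (square_weight \<beta>) n f"
    and len: "mlen \<alpha> = mlen \<delta>"
  shows "\<beta> \<alpha> / sqrt (mfact \<alpha>) * (sqrt (mfact \<delta>) / \<beta> \<delta>) \<le> K"
proof -
  have \<beta>2: "(\<beta> \<alpha>)\<^sup>2 > 0" for \<alpha> using \<beta>[of \<alpha>] by simp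
  have le: "(\<beta> \<alpha>)\<^sup>2 / mfact \<alpha> \<le> K\<^sup>2 * ((\<beta> \<delta>)\<^sup>2 / mfact \<delta>)"
    by (rule weights_comparable[OF \<beta>2 K bound refl len[symmetric]])
  have "sqrt ((\<beta> \<alpha>)\<^sup>2 / mfact \<alpha>) \<le> sqrt (K\<^sup>2 * ((\<beta> \<delta>)\<^sup>2 / mfact \<delta>))"
    by (rule real_sqrt_le_mono[OF le])
  then have "\<beta> \<alpha> / sqrt (mfact \<alpha>) \<le> K * (\<beta> \<delta> / sqrt (mfact \<delta>))"
    using \<beta>[of \<alpha>] \<beta>[of \<delta>] K by (simp add: real_sqrt_divide real_sqrt_mult)
  then have "\<beta> \<alpha> / sqrt (mfact \<alpha>) * (sqrt (mfact \<delta>) / \<beta> \<delta>) \<le> K * (\<beta> \<delta> / sqrt (mfact \<delta>)) * (sqrt (mfact \<delta>) / \<beta> \<delta>)"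
    using \<beta>[of \<delta>] mfact_pos[of \<delta>] by (intro mult_right_mono) auto
  also have "\<dots> = K" using \<beta>[of \<delta>] mfact_pos[of \<delta>] by simp
  finally show ?thesis .
qed

theorem theorem3p5:
  fixes \<beta> :: "nat ^ 'd::finite \<Rightarrow> real"
  assumes "\<And>\<alpha>. \<beta> \<alpha> > 0"
    and "bounded_tuple (H2 \<beta>) (Mz :: ('d, nat ^ 'd) op_tuple)"
  shows
    "(weakly_homogeneous (H2 \<beta>) (Mz :: ('d, nat ^ 'd) op_tuple)
      \<longleftrightarrow>
      (\<exists>\<beta>' :: nat ^ 'd \<Rightarrow> real. (\<forall>\<alpha>. \<beta>' \<alpha> > 0) \<and>
        homogeneous (H2 \<beta>') (Mz :: ('d, nat ^ 'd) op_tuple) \<and>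
        similar_tuples (H2 \<beta>) (Mz :: ('d, nat ^ 'd) op_tuple) (H2 \<beta>') Mz))
     \<and>
     (weakly_homogeneous (H2 \<beta>) (Mz :: ('d, nat ^ 'd) op_tuple)
      \<longleftrightarrow>
      bdd_above (range (\<lambda>n.
        Max ((\<lambda>\<alpha>. hnorm (H2 \<beta>) (zmonom \<alpha>) / sqrt (mfact \<alpha>)) ` {\<alpha>. mlen \<alpha> = n}) *
        Max ((\<lambda>\<delta>. sqrt (mfact \<delta>) / hnorm (H2 \<beta>) (zmonom \<delta>)) ` {\<delta>. mlen \<delta> = n}))))
     \<and>
     (weakly_homogeneous (H2 \<beta>) (Mz :: ('d, nat ^ 'd) op_tuple)
      \<longleftrightarrow>
      (\<forall>u \<in> unitary_group. bounded_op (H2 \<beta>) (H2 \<beta>) (comp_op u)) \<and>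
      bdd_above ((\<lambda>u. opnorm (H2 \<beta>) (H2 \<beta>) (comp_op u)) ` unitary_group))"
    (is "(?i \<longleftrightarrow> ?ii) \<and> (?i \<longleftrightarrow> ?iii) \<and> (?i \<longleftrightarrow> ?iv)")
proof -
  note \<beta> = assms(1)
  have i_iv: "?i \<Longrightarrow> ?iv"
  proof -
    assume i: ?i
    have "\<exists>C. \<forall>n f. degform (square_weight \<beta>) n (comp_op u f) \<le> C * degform (square_weight \<beta>) n f"
      if u: "u \<in> unitary_group" for u :: "complex ^ 'd ^ 'd"
    proof -
      obtain \<Gamma> where \<Gamma>: "invertible_op (H2 \<beta>) (H2 \<beta>) \<Gamma>"
        "\<And>j f. f \<in> hcarrier (H2 \<beta>) \<Longrightarrow> \<Gamma> (Mz j f) = tuple_act u Mz j (\<Gamma> f)"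
        using i u unfolding weakly_homogeneous_def by blast
      show ?thesis by (rule intertwiner_degree_bound[OF \<beta> \<Gamma>])
    qed
    then show ?iv
      unfolding uniformly_bounded_iff by (intro uniform_degree_bound) simp_all
  qed
  have iv_iii: "?iv \<Longrightarrow> ?iii"
    unfolding uniformly_bounded_iff max_condition_iff[OF \<beta>]
    using uniform_bound_imp_comparable[of \<beta>, OF \<beta>] by blast
  have iii_ii: "?iii \<Longrightarrow> ?ii"
    unfolding max_condition_iff[OF \<beta>]
    using comparable_imp_similar_homogeneous[of \<beta>, OF \<beta> assms(2)] by blast
  have ii_i: "?ii \<Longrightarrow> ?i"
    using homogeneous_similar_imp_weakly[OF _ assms(2)] by blast
  show ?thesis
  proof (intro conjI)
    show "?i \<longleftrightarrow> ?ii"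
      by (rule iffI, rule iii_ii, rule iv_iii, erule i_iv, erule ii_i)
    show "?i \<longleftrightarrow> ?iii"
      by (rule iffI, rule iv_iii, erule i_iv, rule ii_i, erule iii_ii)
    show "?i \<longleftrightarrow> ?iv"
      by (rule iffI, erule i_iv, rule ii_i, rule iii_ii, erule iv_iii)
  qed
qed

end
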